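(* Let $\mathbb K$ be a field of characteristic zero, let $L$ be a nilpotent subalgebra of the Lie algebra $W_{3}(\mathbb K)=\mathrm{Der}_{\mathbb K}(\mathbb K[x_1, x_2, x_3])$, and let $F=\{r\in \mathbb K(x_1,x_2,x_3) : D(r)=0 \text{ for all } D\in L\}$ be the field of constants of $L$ in the field $\mathbb K(x_1, x_2, x_3)$. Then the Lie algebra $FL$ (over the field $F$) is isomorphic to a finite dimensional subalgebra of the triangular Lie algebra $u_{3}(F)$.
   Context: Derivations of $\mathbb K[x_1,x_2,x_3]$ are extended uniquely to derivations of the fraction field $\mathbb K(x_1,x_2,x_3)$. $FL$ is the set of all $\mathbb K$-linear combinations of derivations $aD$ of $\mathbb K(x_1,x_2,x_3)$ with $a\in F$, $D\in L$; it is a Lie algebra over $F$. The triangular Lie algebra $u_3(F)\subseteq \mathrm{Der}_F(F[x_1,x_2,x_3])$ consists of all derivations $f\frac{\partial}{\partial x_1}+g\frac{\partial}{\partial x_2}+c\frac{\partial}{\partial x_3}$ with $f\in F[x_2,x_3]$, $g\in F[x_3]$, $c\in F$. Isomorphism and finite dimensionality are over $F$. *)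

theory Defs
  imports "HOL-Computational_Algebra.Computational_Algebra"
begin

section \<open>Derivations\<close>

text \<open>
  \<open>derivations R A\<close> is the set of \<open>R\<close>-linear derivations \<open>A \<Rightarrow> A\<close>, where \<open>A\<close> is a subring of the
  ambient ring and \<open>R \<subseteq> A\<close> is a subring of scalars. A function on \<open>A\<close> is represented by its
  extension by zero to the ambient type, so that equality of derivations is equality of functions
  and the Lie algebra operations are the pointwise ones.
\<close>

definition derivations :: "'a::comm_ring_1 set \<Rightarrow> 'a set \<Rightarrow> ('a \<Rightarrow> 'a) set" where
  "derivations R A = {D.
     (\<forall>p\<in>A. D p \<in> A) \<and> (\<forall>p. p \<notin> A \<longrightarrow> D p = 0) \<and>
     (\<forall>p\<in>A. \<forall>q\<in>A. D (p + q) = D p + D q) \<and>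
     (\<forall>r\<in>R. \<forall>p\<in>A. D (r * p) = r * D p) \<and>
     (\<forall>p\<in>A. \<forall>q\<in>A. D (p * q) = D p * q + p * D q)}"

definition lie_bracket :: "('a::comm_ring_1 \<Rightarrow> 'a) \<Rightarrow> ('a \<Rightarrow> 'a) \<Rightarrow> 'a \<Rightarrow> 'a" where
  "lie_bracket D E = (\<lambda>p. D (E p) - E (D p))"


section \<open>Lie algebras of functions over a ring of scalars\<close>

text \<open>
  In what follows \<open>R\<close> is a set of scalars inside the ring \<open>'a\<close> on which the functions act;
  \<open>r \<in> R\<close> multiplies a function \<open>D\<close> to \<open>\<lambda>p. r * D p\<close>.
\<close>

definition lin_span :: "'a::comm_ring_1 set \<Rightarrow> ('a \<Rightarrow> 'a) set \<Rightarrow> ('a \<Rightarrow> 'a) set" where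
  "lin_span R S = {(\<lambda>p. \<Sum>i<n. r i * D i p) | (n::nat) r D. \<forall>i<n. r i \<in> R \<and> D i \<in> S}"

definition lie_subalgebra ::
  "'a::comm_ring_1 set \<Rightarrow> ('a \<Rightarrow> 'a) set \<Rightarrow> ('a \<Rightarrow> 'a) set \<Rightarrow> bool" where
  "lie_subalgebra R L W \<longleftrightarrow>
     L \<subseteq> W \<and> (\<lambda>_. 0) \<in> L \<and>
     (\<forall>D\<in>L. \<forall>E\<in>L. (\<lambda>p. D p + E p) \<in> L) \<and>
     (\<forall>r\<in>R. \<forall>D\<in>L. (\<lambda>p. r * D p) \<in> L) \<and>
     (\<forall>D\<in>L. \<forall>E\<in>L. lie_bracket D E \<in> L)"

primrec lower_central :: "'a::comm_ring_1 set \<Rightarrow> ('a \<Rightarrow> 'a) set \<Rightarrow> nat \<Rightarrow> ('a \<Rightarrow> 'a) set" where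
  "lower_central R L 0 = L"
| "lower_central R L (Suc n) =
     lin_span R {lie_bracket D E | D E. D \<in> L \<and> E \<in> lower_central R L n}"

definition nilpotent_lie :: "'a::comm_ring_1 set \<Rightarrow> ('a \<Rightarrow> 'a) set \<Rightarrow> bool" where
  "nilpotent_lie R L \<longleftrightarrow> (\<exists>n. lower_central R L n = {\<lambda>_. 0})"

definition fin_dim_over :: "'a::comm_ring_1 set \<Rightarrow> ('a \<Rightarrow> 'a) set \<Rightarrow> bool" where
  "fin_dim_over R L \<longleftrightarrow> (\<exists>B. finite B \<and> B \<subseteq> L \<and> lin_span R B = L)"

text \<open>
  The two Lie algebras may act on different rings \<open>'a\<close> and \<open>'b\<close>; the embedding \<open>\<iota>\<close> identifies
  the scalars \<open>R\<close> of the first with the scalars of the second.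
\<close>

definition lie_isomorphic_over ::
  "'a::comm_ring_1 set \<Rightarrow> ('a \<Rightarrow> 'b::comm_ring_1) \<Rightarrow> ('a \<Rightarrow> 'a) set \<Rightarrow> ('b \<Rightarrow> 'b) set \<Rightarrow> bool" where
  "lie_isomorphic_over R \<iota> L M \<longleftrightarrow> (\<exists>\<phi>. bij_betw \<phi> L M \<and>
     (\<forall>D\<in>L. \<forall>E\<in>L. \<phi> (\<lambda>p. D p + E p) = (\<lambda>q. \<phi> D q + \<phi> E q)) \<and>
     (\<forall>r\<in>R. \<forall>D\<in>L. \<phi> (\<lambda>p. r * D p) = (\<lambda>q. \<iota> r * \<phi> D q)) \<and>
     (\<forall>D\<in>L. \<forall>E\<in>L. \<phi> (lie_bracket D E) = lie_bracket (\<phi> D) (\<phi> E)))"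


section \<open>Polynomials and rational functions in three variables\<close>

text \<open>
  The ring \<open>A[x\<^sub>1,x\<^sub>2,x\<^sub>3]\<close> is \<open>A[x\<^sub>3][x\<^sub>2][x\<^sub>1]\<close>: the outermost variable of \<open>'a poly poly poly\<close> is
  \<open>x\<^sub>1\<close>, the innermost \<open>x\<^sub>3\<close>. In particular a polynomial in \<open>x\<^sub>2,x\<^sub>3\<close> alone is a constant \<open>[:f:]\<close>.
\<close>

type_synonym 'a poly3 = "'a poly poly poly"
type_synonym 'a ratfun3 = "'a poly poly poly fract"

definition const3 :: "'a::comm_ring_1 \<Rightarrow> 'a poly3" where
  "const3 c = [:[:[:c:]:]:]"

definition const_rat3 :: "'a::field \<Rightarrow> 'a ratfun3" where
  "const_rat3 c = to_fract (const3 c)"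

definition d1 :: "'a::idom poly3 \<Rightarrow> 'a poly3" where
  "d1 = pderiv"

definition d2 :: "'a::idom poly3 \<Rightarrow> 'a poly3" where
  "d2 = map_poly pderiv"

definition d3 :: "'a::idom poly3 \<Rightarrow> 'a poly3" where
  "d3 = map_poly (map_poly pderiv)"

definition polys_over :: "'a::zero set \<Rightarrow> 'a poly set" where
  "polys_over A = {p. \<forall>i. coeff p i \<in> A}"

abbreviation polys3_over :: "'a::zero set \<Rightarrow> 'a poly3 set" where
  "polys3_over A \<equiv> polys_over (polys_over (polys_over A))"

definition W3 :: "('a::field poly3 \<Rightarrow> 'a poly3) set" where
  "W3 = derivations (range const3) UNIV"

definition u3 :: "'a::field set \<Rightarrow> ('a poly3 \<Rightarrow> 'a poly3) set" where
  "u3 F = {D \<in> derivations (const3 ` F) (polys3_over F).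
     \<exists>f \<in> polys_over (polys_over F). \<exists>g \<in> polys_over F. \<exists>c \<in> F.
       \<forall>p \<in> polys3_over F. D p = [:f:] * d1 p + [:[:g:]:] * d2 p + const3 c * d3 p}"


section \<open>Extension to rational functions\<close>

definition extends_der ::
  "('a::field poly3 \<Rightarrow> 'a poly3) \<Rightarrow> ('a ratfun3 \<Rightarrow> 'a ratfun3) \<Rightarrow> bool" where
  "extends_der d D \<longleftrightarrow>
     D \<in> derivations (range const_rat3) UNIV \<and> (\<forall>p. D (to_fract p) = to_fract (d p))"

definition der_ext :: "('a::field poly3 \<Rightarrow> 'a poly3) \<Rightarrow> 'a ratfun3 \<Rightarrow> 'a ratfun3" where
  "der_ext d = (THE D. extends_der d D)"

lemma derivations_UNIV_D:
  assumes "D \<in> derivations R UNIV"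
  shows "D (p + q) = D p + D q" "D (p * q) = D p * q + p * D q" "r \<in> R \<Longrightarrow> D (r * p) = r * D p"
  using assms by (auto simp: derivations_def)

lemma extends_der_Fract:
  assumes D: "extends_der d D" and b: "b \<noteq> 0"
  shows "D (Fract a b) = (to_fract (d a) * to_fract b - to_fract a * to_fract (d b)) / (to_fract b)\<^sup>2"
proof -
  have E: "D \<in> derivations (range const_rat3) UNIV" and e: "\<And>p. D (to_fract p) = to_fract (d p)"
    using D by (auto simp: extends_der_def)
  have f: "Fract a b * to_fract b = to_fract a"
    using b by (simp add: to_fract_def eq_fract)
  have b': "to_fract b \<noteq> 0" using b by simp
  have "to_fract (d a) = D (Fract a b) * to_fract b + Fract a b * to_fract (d b)"
    using derivations_UNIV_D(2)[OF E, of "Fract a b" "to_fract b"] by (simp add: f e)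
  moreover have "Fract a b = to_fract a / to_fract b" using f b' by (simp add: field_simps)
  ultimately have "to_fract (d a) = D (Fract a b) * to_fract b + to_fract a / to_fract b * to_fract (d b)"
    by simp
  thus ?thesis using b' by (simp add: field_simps power2_eq_square)
qed

lemma ex_extends_der:
  assumes d: "d \<in> W3"
  shows "\<exists>D. extends_der d D"
proof -
  have d': "d \<in> derivations (range const3) UNIV" using d by (simp add: W3_def)
  note dp = derivations_UNIV_D[OF d']
  define Q where "Q a b = (to_fract (d a) * to_fract b - to_fract a * to_fract (d b)) / (to_fract b)\<^sup>2"
    for a b
  define D where "D r = (case SOME (a,b). b \<noteq> 0 \<and> r = Fract a b of (a,b) \<Rightarrow> Q a b)" for r
  have indep: "Q a b = Q a' b'"
    if h: "b \<noteq> 0" "b' \<noteq> 0" "Fract a b = Fract a' b'" for a b a' b'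
  proof -
    define A B A' B' U V U' V' where
      defs: "A = to_fract a" "B = to_fract b" "A' = to_fract a'" "B' = to_fract b'"
      "U = to_fract (d a)" "V = to_fract (d b)" "U' = to_fract (d a')" "V' = to_fract (d b')"
    have e: "a * b' = a' * b" using h by (simp add: eq_fract)
    have e1: "A * B' = A' * B"
      using arg_cong[OF e, of to_fract] by (simp add: defs)
    have e2: "U * B' + A * V' = U' * B + A' * V"
      using arg_cong[OF e, of "\<lambda>p. to_fract (d p)"] by (simp add: defs dp)
    have nz: "B \<noteq> 0" "B' \<noteq> 0" using h by (simp_all add: defs)
    have A: "A = A' * B / B'" using e1 nz by (simp add: field_simps)
    have U: "U = (U' * B + A' * V - A * V') / B'" using e2 nz by (simp add: field_simps)
    have "(U * B - A * V) / B\<^sup>2 = (U' * B' - A' * V') / B'\<^sup>2"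
      unfolding U A using nz by (simp add: field_simps power2_eq_square)
    thus ?thesis by (simp add: Q_def defs)
  qed
  have DF: "D (Fract a b) = Q a b" if "b \<noteq> 0" for a b
  proof -
    have "case (SOME (a',b'). b' \<noteq> 0 \<and> Fract a b = Fract a' b') of
            (a',b') \<Rightarrow> b' \<noteq> 0 \<and> Fract a b = Fract a' b'"
      by (rule someI[of _ "(a,b)"]) (use that in simp)
    thus ?thesis unfolding D_def
      by (auto split: prod.splits intro!: indep that[THEN indep] simp: that)
  qed
  have add: "D (r + s) = D r + D s" for r s
  proof -
    obtain a b where r: "r = Fract a b" "b \<noteq> 0" by (cases r) auto
    obtain a' b' where s: "s = Fract a' b'" "b' \<noteq> 0" by (cases s) auto
    show ?thesis using r s
      by (simp add: DF Q_def dp field_simps power2_eq_square)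
  qed
  have mult: "D (r * s) = D r * s + r * D s" for r s
  proof -
    obtain a b where r: "r = Fract a b" "b \<noteq> 0" by (cases r) auto
    obtain a' b' where s: "s = Fract a' b'" "b' \<noteq> 0" by (cases s) auto
    have q: "Fract a b = to_fract a / to_fract b" "Fract a' b' = to_fract a' / to_fract b'"
      using r s by (simp_all add: to_fract_def)
    have "D (r * s) = Q (a * a') (b * b')" using r s by (simp add: DF)
    also have "\<dots> = Q a b * (to_fract a' / to_fract b') + (to_fract a / to_fract b) * Q a' b'"
      using r(2) s(2) by (simp add: Q_def dp field_simps power2_eq_square)
    also have "\<dots> = D r * s + r * D s" unfolding r(1) s(1) DF[OF r(2)] DF[OF s(2)] by (simp only: q)
    finally show ?thesis .
  qed
  have "d 1 = d 1 + d 1" using dp(2)[of 1 1] by (simp only: mult_1_left mult_1_right)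
  hence d1: "d 1 = 0" by (simp only: add_cancel_right_right)
  have ext: "D (to_fract p) = to_fract (d p)" for p
    by (simp add: to_fract_def[of p] DF Q_def d1)
  have const: "D (const_rat3 c) = 0" for c
    using dp(3)[of "const3 c" 1] by (simp add: const_rat3_def ext d1)
  have "extends_der d D"
    unfolding extends_der_def derivations_def by (auto simp: add mult ext const)
  thus ?thesis by (rule exI[of _ D])
qed

lemma der_ext_unique_existence:
  assumes "d \<in> W3"
  shows "\<exists>!D. extends_der d D"
proof -
  have "D = E" if "extends_der d D" "extends_der d E" for D E
  proof
    fix r show "D r = E r"
      by (cases r) (simp add: extends_der_Fract[OF that(1)] extends_der_Fract[OF that(2)])
  qed
  thus ?thesis using ex_extends_der[OF assms] by blast
qed

definition const_field :: "('a::field poly3 \<Rightarrow> 'a poly3) set \<Rightarrow> 'a ratfun3 set" where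
  "const_field L = {r. \<forall>D\<in>L. der_ext D r = 0}"

text \<open>The Lie algebra \<open>FL\<close>, for \<open>F\<close> a set of rational functions.\<close>

definition scaled_alg ::
  "'a::field ratfun3 set \<Rightarrow> ('a poly3 \<Rightarrow> 'a poly3) set \<Rightarrow> ('a ratfun3 \<Rightarrow> 'a ratfun3) set" where
  "scaled_alg F L = lin_span (range const_rat3) {(\<lambda>r. a * der_ext D r) | a D. a \<in> F \<and> D \<in> L}"

end

(*
  Nilpotency yields elements D1, D2, D3 of (the extension of) L, some of them possibly zero, such
  that D1 is central, [L, D2] lies in R D1 and [L, D3] lies in R D1 + R D2, where
  R = K(x1,x2,x3), and such that every D in L is a1 D1 + a2 D2 + a3 D3 with a1, a2, a3 in R. The
  bracket conditions give D1 ai = 0, D2 a2 = 0 and a3 in F; nilpotency moreover forces a1, a2 and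
  the element c with [D3, D2] = c D1 into the ring A of those f with D1 f = 0 that are killed by
  all long words in D2 and D3. On A the derivations D2 and D3 commute, and their common kernel is
  F. Taylor expansion, followed by a retraction of A onto F, embeds A into F[x2,x3] and turns D2
  and D3 into the partial derivatives. Expanding coefficients, and sending D1, D2, D3 to d/dx1,
  d/dx2, h d/dx1 + d/dx3 with dh/dx2 = -(expansion of c), embeds FL into u3(F); the words have
  bounded length, so the expansions have bounded degree.
*)
theory Submission
  imports Defs
begin

text \<open>Over R the algebra FL may have any rank from 0 to 3. Admitting zero fields, whose
  coefficients are normalised to 0, treats all ranks at once. The obstacle is that A need not
  contain coordinates: D2 or D3 may act on A as zero, so A cannot simply be identified with
  F[x2,x3]. The map exp(x2 D2 + x3 D3) always exists on A and is a ring homomorphism, but its values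
  lie in A[x2,x3]. A retraction of A onto F, that is, an F-rational point of A, brings the
  coefficients down to F. No information is lost: if the expansion of f vanishes, so do those of D2
  f and D3 f; induction on word length makes f a constant, and a constant is its own expansion.
  Nilpotency reaches the coefficients because the brackets of D2 and D3 with a1 D1 + a2 D2 + a3 D3
  have coordinates (D2 a1 - a3 c, 0, 0) and (D3 a1 + a2 c, D3 a2, 0). Up to terms in c,
  differentiating coefficients thus means descending in the lower central series. The equation for h
  comes from [h d/dx1 + d/dx3, d/dx2] = -(dh/dx2) d/dx1, which has to be the image of c D1.\<close>

instance fract :: ("{idom,ring_char_0}") field_char_0
proof
  show "inj (of_nat :: nat \<Rightarrow> 'a fract)"
    by (simp add: inj_on_def of_nat_fract eq_fract)
qed

section \<open>Derivations and spans\<close>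

lemma derivation_simps:
  assumes "D \<in> derivations R UNIV"
  shows "D (p + q) = D p + D q" "D (p * q) = D p * q + p * D q" "D 0 = 0" "D 1 = 0"
    "D (- p) = - D p" "D (p - q) = D p - D q"
proof -
  note d = derivations_UNIV_D[OF assms]
  show a: "D (p + q) = D p + D q" and "D (p * q) = D p * q + p * D q" for p q
    by (rule d)+
  show z: "D 0 = 0" using a[of 0 0] by simp
  have "D 1 = D 1 + D 1" using d(2)[of 1 1] by (simp only: mult_1_left mult_1_right)
  then show "D 1 = 0" by (simp only: add_cancel_right_right)
  show m: "D (- p) = - D p" for p using a[of "- p" p] z by (simp add: eq_neg_iff_add_eq_0)
  show "D (p - q) = D p - D q" using a[of p "- q"] m by simp
qed

lemma derivation_scalar:
  assumes "D \<in> derivations R UNIV" "r \<in> R"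
  shows "D r = 0"
  using derivations_UNIV_D(3)[OF assms(1) assms(2), of 1] derivation_simps(4)[OF assms(1)] by simp

lemma derivation_inverse:
  fixes D :: "'a::field \<Rightarrow> 'a"
  assumes "D \<in> derivations R UNIV" "D x = 0"
  shows "D (inverse x) = 0"
proof (cases "x = 0")
  case False
  then have "D (x * inverse x) = 0" using derivation_simps(4)[OF assms(1)] by simp
  then show ?thesis using False assms(2) unfolding derivation_simps(2)[OF assms(1)] by simp
qed (simp add: derivation_simps[OF assms(1)])

lemma derivation_of_nat:
  assumes "D \<in> derivations R UNIV"
  shows "D (of_nat n) = 0"
  by (induction n) (simp_all add: derivation_simps[OF assms])

lemma derivation_lie_bracket:
  assumes D: "D \<in> derivations R UNIV" and E: "E \<in> derivations R UNIV"
  shows "lie_bracket D E \<in> derivations R UNIV"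
  unfolding derivations_def lie_bracket_def
  by (auto simp: derivation_simps[OF D] derivation_simps[OF E] derivation_scalar[OF D]
      derivation_scalar[OF E] algebra_simps)

section \<open>Linear spans\<close>

lemma zero_in_lin_span: "(\<lambda>_. 0) \<in> lin_span R S"
  unfolding lin_span_def by (rule CollectI, rule exI[of _ 0]) simp

lemma step_in_lin_span:
  assumes "r \<in> R" "D \<in> S" "E \<in> lin_span R S"
  shows "(\<lambda>p. r * D p + E p) \<in> lin_span R S"
proof -
  have "\<exists>n s Es. E = (\<lambda>p. \<Sum>i<n. s i * Es i p) \<and> (\<forall>i<(n::nat). s i \<in> R \<and> Es i \<in> S)"
    using assms(3) by (simp add: lin_span_def)
  then obtain n s Es where E: "E = (\<lambda>p. \<Sum>i<n. s i * Es i p)"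
    and m: "\<And>i. i < (n::nat) \<Longrightarrow> s i \<in> R \<and> Es i \<in> S"
    by (elim exE conjE) simp
  let ?s = "case_nat r s" and ?E = "case_nat D Es"
  have "(\<lambda>p. r * D p + E p) = (\<lambda>p. \<Sum>i<Suc n. ?s i * ?E i p)"
    unfolding sum.lessThan_Suc_shift by (simp add: E)
  moreover have "\<forall>i<Suc n. ?s i \<in> R \<and> ?E i \<in> S"
    using m assms(1,2) by (auto simp: less_Suc_eq_0_disj)
  ultimately show ?thesis unfolding lin_span_def by blast
qed

text \<open>Induction on the number of summands; in the step \<open>E\<close> is the part of the sum
  already treated.\<close>

lemma lin_span_induct [consumes 1, case_names zero step]:
  assumes "E \<in> lin_span R S"
    and z: "P (\<lambda>_. 0)"
    and s: "\<And>r D E. r \<in> R \<Longrightarrow> D \<in> S \<Longrightarrow> E \<in> lin_span R S \<Longrightarrow> P E \<Longrightarrow> P (\<lambda>p. r * D p + E p)"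
  shows "P E"
proof -
  have "P (\<lambda>p. \<Sum>i<n. r i * D i p) \<and> (\<lambda>p. \<Sum>i<n. r i * D i p) \<in> lin_span R S"
    if "\<And>i. i < n \<Longrightarrow> r i \<in> R \<and> D i \<in> S" for n :: nat and r D
    using that
  proof (induction n)
    case 0
    then show ?case by (simp add: z zero_in_lin_span)
  next
    case (Suc n)
    then have IH: "P (\<lambda>p. \<Sum>i<n. r i * D i p)" "(\<lambda>p. \<Sum>i<n. r i * D i p) \<in> lin_span R S"
      by simp_all
    have m: "r n \<in> R" "D n \<in> S" using Suc.prems[of n] by simp_all
    note s[OF m IH(2,1)] step_in_lin_span[OF m IH(2)]
    then show ?case by (simp add: add.commute)
  qed
  moreover have "\<exists>n r D. E = (\<lambda>p. \<Sum>i<n. r i * D i p) \<and> (\<forall>i<(n::nat). r i \<in> R \<and> D i \<in> S)"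
    using assms(1) by (simp add: lin_span_def)
  ultimately show ?thesis by (elim exE conjE) simp
qed

lemma lin_span_subset:
  assumes "S \<subseteq> V" "(\<lambda>_. 0) \<in> V"
    and "\<And>D E. D \<in> V \<Longrightarrow> E \<in> V \<Longrightarrow> (\<lambda>p. D p + E p) \<in> V"
    and "\<And>r D. r \<in> R \<Longrightarrow> D \<in> V \<Longrightarrow> (\<lambda>p. r * D p) \<in> V"
  shows "lin_span R S \<subseteq> V"
proof
  fix E assume "E \<in> lin_span R S"
  then show "E \<in> V" by (induction rule: lin_span_induct) (use assms in blast)+
qed

lemma lin_span_superset:
  assumes "D \<in> S" "(1::'a::comm_ring_1) \<in> R"
  shows "D \<in> lin_span R S"
  using step_in_lin_span[OF assms(2,1) zero_in_lin_span] by simp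

lemma lin_span_add:
  assumes "D \<in> lin_span R S" "E \<in> lin_span R S"
  shows "(\<lambda>p. D p + E p) \<in> lin_span R S"
  using assms(1)
proof (induction rule: lin_span_induct)
  case (step r D D')
  from step_in_lin_span[OF step(1,2,4)] show ?case by (simp add: add.assoc)
qed (simp add: assms(2))

lemma lin_span_mono:
  assumes "S \<subseteq> S'" shows "lin_span R S \<subseteq> lin_span R S'"
  unfolding lin_span_def using assms by blast

section \<open>Subfields and finite dimension\<close>

definition subring_set :: "'a::comm_ring_1 set \<Rightarrow> bool" where
  "subring_set A \<longleftrightarrow> 0 \<in> A \<and> 1 \<in> A \<and> (\<forall>x\<in>A. \<forall>y\<in>A. x + y \<in> A) \<and> (\<forall>x\<in>A. - x \<in> A) \<and>
     (\<forall>x\<in>A. \<forall>y\<in>A. x * y \<in> A)"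

lemma subring_setD:
  assumes "subring_set A"
  shows "0 \<in> A" "1 \<in> A" "x \<in> A \<Longrightarrow> y \<in> A \<Longrightarrow> x + y \<in> A" "x \<in> A \<Longrightarrow> - x \<in> A"
    "x \<in> A \<Longrightarrow> y \<in> A \<Longrightarrow> x * y \<in> A" "x \<in> A \<Longrightarrow> y \<in> A \<Longrightarrow> x - y \<in> A" "of_nat n \<in> A"
proof -
  have n: "of_nat n \<in> A" for n
    using assms unfolding subring_set_def by (induction n) auto
  show "0 \<in> A" "1 \<in> A" "x \<in> A \<Longrightarrow> y \<in> A \<Longrightarrow> x + y \<in> A" "x \<in> A \<Longrightarrow> - x \<in> A"
    "x \<in> A \<Longrightarrow> y \<in> A \<Longrightarrow> x * y \<in> A" "of_nat n \<in> A"
    using assms n unfolding subring_set_def by auto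
  show "x \<in> A \<Longrightarrow> y \<in> A \<Longrightarrow> x - y \<in> A"
    using assms unfolding subring_set_def by (metis diff_conv_add_uminus)
qed

lemma subring_set_sum:
  assumes "subring_set A" "\<And>i. i \<in> I \<Longrightarrow> f i \<in> A"
  shows "sum f I \<in> A"
  using assms(2) by (induction I rule: infinite_finite_induct) (auto simp: subring_setD[OF assms(1)])

text \<open>Finitely many functionals that separate points embed \<open>V\<close> into a finite
  power of \<open>F\<close>. The induction removes one functional: its kernel is generated by a
  finite set, and at most one further vector is needed outside it. Scalars pass through
  \<open>\<iota>\<close> because the operators act on a ring in which \<open>F\<close> is
  embedded.\<close>

lemma fin_dim_over_functionals:
  fixes \<iota> :: "'a::field \<Rightarrow> 'b::comm_ring_1" and V :: "('b \<Rightarrow> 'b) set"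
  assumes F: "subring_set F" "\<And>x. x \<in> F \<Longrightarrow> inverse x \<in> F"
    and \<iota>: "\<iota> 0 = 0" "\<iota> 1 = 1" "\<And>x y. \<iota> (x + y) = \<iota> x + \<iota> y" "\<And>x y. \<iota> (x * y) = \<iota> x * \<iota> y"
    and V: "(\<lambda>_. 0) \<in> V" "\<And>D E. D \<in> V \<Longrightarrow> E \<in> V \<Longrightarrow> (\<lambda>p. D p + E p) \<in> V"
      "\<And>r D. r \<in> F \<Longrightarrow> D \<in> V \<Longrightarrow> (\<lambda>p. \<iota> r * D p) \<in> V"
    and l: "finite I" "\<And>i D. i \<in> I \<Longrightarrow> D \<in> V \<Longrightarrow> l i D \<in> F"
      "\<And>i D E. i \<in> I \<Longrightarrow> D \<in> V \<Longrightarrow> E \<in> V \<Longrightarrow> l i (\<lambda>p. D p + E p) = l i D + l i E"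
      "\<And>i r D. i \<in> I \<Longrightarrow> r \<in> F \<Longrightarrow> D \<in> V \<Longrightarrow> l i (\<lambda>p. \<iota> r * D p) = r * l i D"
    and sep: "\<And>D. D \<in> V \<Longrightarrow> (\<And>i. i \<in> I \<Longrightarrow> l i D = 0) \<Longrightarrow> D = (\<lambda>_. 0)"
  shows "fin_dim_over (\<iota> ` F) V"
  using l V sep
proof (induction I arbitrary: V rule: finite_induct)
  case empty
  then have "V = {\<lambda>_. 0}" by blast
  moreover have "lin_span (\<iota> ` F) {} = {\<lambda>_. 0}"
    by (auto intro: zero_in_lin_span elim: lin_span_induct)
  ultimately show ?case unfolding fin_dim_over_def by (intro exI[of _ "{}"]) auto
next
  case (insert i I)
  note V = insert.prems(4-6) and lF = insert.prems(1) and ladd = insert.prems(2) and lsc = insert.prems(3)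
  define V' where "V' = {D \<in> V. l i D = 0}"
  have l0: "l i (\<lambda>_. 0) = 0" using ladd[of i "\<lambda>_. 0" "\<lambda>_. 0", OF _ V(1) V(1)]
    by (simp only: insertI1 add_0 add_cancel_right_right simp_thms)
  have "fin_dim_over (\<iota> ` F) V'"
  proof (rule insert.IH)
    show "D = (\<lambda>_. 0)" if "D \<in> V'" "\<And>j. j \<in> I \<Longrightarrow> l j D = 0" for D
      using insert.prems(7)[of D] that by (auto simp: V'_def)
  qed (use V lF ladd lsc l0 in \<open>auto simp: V'_def\<close>)
  then obtain B where B: "finite B" "B \<subseteq> V'" "lin_span (\<iota> ` F) B = V'"
    unfolding fin_dim_over_def by blast
  show ?case
  proof (cases "V' = V")
    case True
    then show ?thesis using B unfolding fin_dim_over_def by blast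
  next
    case False
    then obtain v where v: "v \<in> V" "l i v \<noteq> 0" unfolding V'_def by blast
    let ?B = "insert v B"
    have "lin_span (\<iota> ` F) ?B \<subseteq> V"
      by (rule lin_span_subset) (use V B v in \<open>auto simp: V'_def\<close>)
    moreover have "D \<in> lin_span (\<iota> ` F) ?B" if D: "D \<in> V" for D
    proof -
      \<comment> \<open>Subtracting \<open>r\<close> times \<open>v\<close> moves \<open>D\<close>
        into the kernel of \<open>l i\<close>.\<close>
      define r where "r = l i D * inverse (l i v)"
      have lr: "l i D \<in> F" "l i v \<in> F" using lF D v by blast+
      then have r: "r \<in> F" "- r \<in> F" using F by (auto simp: r_def subring_setD[OF F(1)])
      let ?E = "\<lambda>p. D p + \<iota> (- r) * v p"
      have "?E \<in> V" using V D v r by blast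
      moreover have "l i ?E = 0"
        using ladd[of i D "\<lambda>p. \<iota> (- r) * v p"] lsc[of i "- r" v] D v r V by (simp add: r_def)
      ultimately have "?E \<in> lin_span (\<iota> ` F) ?B"
        using B lin_span_mono[of B ?B] unfolding V'_def by blast
      moreover have "\<iota> r \<in> \<iota> ` F" using r by blast
      ultimately have "(\<lambda>p. \<iota> r * v p + ?E p) \<in> lin_span (\<iota> ` F) ?B"
        by (intro step_in_lin_span) auto
      moreover have "\<iota> r + \<iota> (- r) = 0" using \<iota>(3)[of r "- r"] \<iota>(1) by simp
      then have "\<iota> (- r) = - \<iota> r" by (simp add: eq_neg_iff_add_eq_0 add.commute)
      ultimately show ?thesis by simp
    qed
    ultimately have "lin_span (\<iota> ` F) ?B = V" by blast
    then show ?thesis unfolding fin_dim_over_def using B v by (intro exI[of _ ?B]) (auto simp: V'_def)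
  qed
qed

section \<open>Retraction onto the kernel of a locally nilpotent derivation\<close>

text \<open>Each application of \<open>D\<close> trades a factor \<open>y\<close> for an integer.
  The integer is absorbed into \<open>u\<close>, which is why \<open>u\<close> is an arbitrary
  element of the kernel.\<close>

lemma funpow_derivation_slice:
  fixes D :: "'a::field_char_0 \<Rightarrow> 'a"
  assumes D: "D \<in> derivations R UNIV" and y: "D y = 1" and u: "D u = 0"
  shows "(D ^^ n) (y ^ n * u) = fact n * u"
  using u
proof (induction n arbitrary: u)
  case (Suc n)
  note d = derivation_simps[OF D]
  have p: "D (y ^ m) = of_nat m * y ^ (m - 1)" for m
  proof (induction m)
    case (Suc m) then show ?case by (cases m) (simp_all add: d y algebra_simps)
  qed (simp add: d)
  have "D (y ^ Suc n * u) = y ^ n * (of_nat (Suc n) * u)"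
    unfolding d(2) p Suc.prems by (simp add: algebra_simps)
  moreover have "D (of_nat (Suc n) * u) = 0"
    by (simp only: d derivation_of_nat[OF D] Suc.prems) simp
  ultimately have "(D ^^ Suc n) (y ^ Suc n * u) = fact n * (of_nat (Suc n) * u)"
    using Suc.IH[of "of_nat (Suc n) * u"] by (simp only: funpow_Suc_right o_apply)
  then show ?case by (simp add: algebra_simps)
qed simp

text \<open>
  If \<open>D y = 1\<close> then \<open>A\<close> is the direct sum of the kernel of \<open>D\<close> and the ideal \<open>y A\<close>, and the
  retraction is the projection onto the kernel.
\<close>

lemma slice_retraction:
  fixes D :: "'a::field_char_0 \<Rightarrow> 'a"
  assumes D: "D \<in> derivations R UNIV"
    and A: "subring_set A" "\<And>f n. f \<in> A \<Longrightarrow> f / of_nat n \<in> A"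
    and stable: "\<And>f. f \<in> A \<Longrightarrow> D f \<in> A"
    and nil: "\<And>f. f \<in> A \<Longrightarrow> \<exists>n. (D ^^ n) f = 0"
    and y: "y \<in> A" "D y = 1"
  shows "\<exists>e. (\<forall>f\<in>A. e f \<in> A \<and> D (e f) = 0) \<and> (\<forall>f\<in>A. D f = 0 \<longrightarrow> e f = f) \<and>
     (\<forall>f\<in>A. \<forall>g\<in>A. e (f + g) = e f + e g) \<and> (\<forall>f\<in>A. \<forall>g\<in>A. e (f * g) = e f * e g)"
proof -
  note d = derivation_simps[OF D] and a = subring_setD[OF A(1)]
  \<comment> \<open>\<open>P f g\<close> expresses that \<open>g\<close> is the component of
    \<open>f\<close> in the kernel of \<open>D\<close>, along the ideal \<open>y A\<close>.\<close>
  define P where "P f g \<longleftrightarrow> g \<in> A \<and> D g = 0 \<and> (\<exists>b\<in>A. f - g = y * b)" for f g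
  have dn: "(D ^^ n) (f - g) = (D ^^ n) f - (D ^^ n) g" for n f g
    by (induction n) (simp_all add: d)
  have stab: "(D ^^ n) f \<in> A" if "f \<in> A" for n f
    using that stable by (induction n) auto
  have powA: "y ^ n \<in> A" for n
    using a y by (induction n) auto
  have factA: "f / fact n \<in> A" if "f \<in> A" for f n
    using A(2)[of f "fact n"] that by simp
  \<comment> \<open>Induction on the order of nilpotency of \<open>f\<close>: if
    \<open>n + 1\<close> applications of \<open>D\<close> kill \<open>f\<close>, then
    \<open>u\<close>, the \<open>n\<close>-th derivative, lies in the kernel, and subtracting
    \<open>y ^ n * (u / fact n)\<close> lowers the order.\<close>
  have ex: "\<exists>g. P f g" if "f \<in> A" for f
  proof -
    have "\<exists>g. P f g" if "(D ^^ n) f = 0" "f \<in> A" for n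
      using that
    proof (induction n arbitrary: f)
      case 0
      then show ?case using a y by (intro exI[of _ 0]) (auto simp: P_def d intro!: bexI[of _ 0])
    next
      case (Suc n)
      define u where "u = (D ^^ n) f"
      have u: "u \<in> A" "D u = 0" using Suc.prems stab by (auto simp: u_def)
      define f' where "f' = f - y ^ n * (u / fact n)"
      have v: "D (u / fact n) = 0"
      proof -
        have "D (u * inverse (of_nat (fact n))) = 0"
          unfolding d(2) u(2) derivation_inverse[OF D derivation_of_nat[OF D]] by simp
        then show ?thesis by (simp add: divide_inverse)
      qed
      have "f' \<in> A" using a u Suc.prems powA factA by (simp add: f'_def)
      moreover have "(D ^^ n) f' = 0"
        unfolding f'_def dn funpow_derivation_slice[OF D y(2) v] by (simp add: u_def)
      ultimately obtain g where g: "P f' g" using Suc.IH by blast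
      show ?case
      proof (cases n)
        case 0
        \<comment> \<open>Here the subtracted term has no factor \<open>y\<close>, but
          \<open>f\<close> already lies in the kernel.\<close>
        then have "P f f" using Suc.prems a by (auto simp: P_def intro!: bexI[of _ 0])
        then show ?thesis by blast
      next
        case (Suc m)
        from g obtain b where b: "g \<in> A" "D g = 0" "b \<in> A" "f' - g = y * b" by (auto simp: P_def)
        have "f - g = y * (b + y ^ m * (u / fact n))"
          using b(4) by (simp add: f'_def Suc algebra_simps)
        moreover have "b + y ^ m * (u / fact n) \<in> A" using a b u powA factA by simp
        ultimately have "P f g" using b by (auto simp: P_def)
        then show ?thesis by blast
      qed
    qed
    then show ?thesis using nil that by blast
  qed
  \<comment> \<open>An element \<open>y b\<close> of the kernel satisfies
    \<open>b + y * D b = 0\<close>. Differentiating raises the integer coefficient of the first term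
    by one, hence the general \<open>k\<close>; the induction is on the order of nilpotency of
    \<open>b\<close>.\<close>
  have zero: "b = 0" if "of_nat (Suc k) * b + y * D b = 0" "(D ^^ n) b = 0" for k n b
    using that
  proof (induction n arbitrary: k b)
    case (Suc n)
    have "D (of_nat (Suc k) * b + y * D b) = 0" by (simp only: Suc.prems(1) d)
    then have "of_nat (Suc (Suc k)) * D b + y * D (D b) = 0"
      by (simp only: d derivation_of_nat[OF D] y) (simp add: algebra_simps)
    moreover have "(D ^^ n) (D b) = 0" using Suc.prems(2) by (simp only: funpow_Suc_right o_apply)
    ultimately have "D b = 0" by (rule Suc.IH)
    then have "of_nat (Suc k) * b = 0" using Suc.prems(1) by simp
    then show ?case by (simp del: of_nat_Suc)
  qed simp
  have uniq: "g = h" if "P f g" "P f h" for f g h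
  proof -
    obtain b c where bc: "b \<in> A" "c \<in> A" "f - g = y * b" "f - h = y * c" "D g = 0" "D h = 0"
      using \<open>P f g\<close> \<open>P f h\<close> by (auto simp: P_def)
    have e: "h - g = y * (b - c)" using bc(3,4) by (simp add: algebra_simps)
    have "D (y * (b - c)) = 0" unfolding e[symmetric] d bc by simp
    then have "of_nat (Suc 0) * (b - c) + y * D (b - c) = 0"
      unfolding d(2) y(2) by simp
    moreover obtain n where "(D ^^ n) (b - c) = 0" using nil[OF a(6)[OF bc(1,2)]] ..
    ultimately have "b - c = 0" by (rule zero)
    then show ?thesis using e by simp
  qed
  define e where "e f = (THE g. P f g)" for f
  have P: "P f (e f)" if "f \<in> A" for f
    unfolding e_def using ex[OF that] uniq by (metis theI)
  have eI: "e f = g" if "P f g" for f g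
    unfolding e_def using that uniq by blast
  have "e (f + g) = e f + e g" if "f \<in> A" "g \<in> A" for f g
  proof (rule eI)
    from P[OF that(1)] P[OF that(2)] obtain b c where bc: "b \<in> A" "c \<in> A" "f - e f = y * b" "g - e g = y * c"
      by (auto simp: P_def)
    then have "f + g - (e f + e g) = y * (b + c)" by (simp add: algebra_simps)
    then show "P (f + g) (e f + e g)" using P[OF that(1)] P[OF that(2)] bc a by (auto simp: P_def d)
  qed
  moreover have "e (f * g) = e f * e g" if "f \<in> A" "g \<in> A" for f g
  proof (rule eI)
    from P[OF that(1)] P[OF that(2)] obtain b c where bc: "b \<in> A" "c \<in> A" "f - e f = y * b" "g - e g = y * c"
      by (auto simp: P_def)
    have "f * g - e f * e g = (f - e f) * g + e f * (g - e g)" by (simp add: algebra_simps)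
    also have "\<dots> = y * (b * g + e f * c)" by (simp add: bc algebra_simps)
    finally show "P (f * g) (e f * e g)" using P[OF that(1)] P[OF that(2)] bc a that by (auto simp: P_def d)
  qed
  moreover have "e f = f" if "f \<in> A" "D f = 0" for f
    by (rule eI) (use that a in \<open>auto simp: P_def intro!: bexI[of _ 0]\<close>)
  ultimately show ?thesis using P by (intro exI[of _ e]) (auto simp: P_def)
qed

section \<open>Triangular vector fields\<close>

lemma derivation_sum:
  assumes "D \<in> derivations R UNIV"
  shows "D (sum f I) = (\<Sum>i\<in>I. D (f i))"
  by (induction I rule: infinite_finite_induct) (simp_all add: derivation_simps[OF assms])

lemma pderiv_derivation: "pderiv \<in> derivations {} (UNIV :: 'a::idom poly set)"
  by (auto simp: derivations_def pderiv_add pderiv_mult algebra_simps)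

text \<open>The partial derivatives \<open>d2\<close> and \<open>d3\<close> arise from
  \<open>pderiv\<close> by this lifting. With an empty set of scalars it can be iterated through the
  nested coefficient rings.\<close>

lemma map_poly_derivation:
  assumes D: "D \<in> derivations {} (UNIV :: 'a::idom set)"
  shows "map_poly D \<in> derivations {} UNIV"
proof -
  note d = derivation_simps[OF D]
  have "map_poly D (p + q) = map_poly D p + map_poly D q" for p q
    by (rule poly_eqI) (simp add: coeff_map_poly d)
  moreover have "map_poly D (p * q) = map_poly D p * q + p * map_poly D q" for p q
    by (rule poly_eqI)
      (simp add: coeff_map_poly coeff_mult d derivation_sum[OF D] sum.distrib)
  ultimately show ?thesis by (simp add: derivations_def)
qed

lemma pderiv_map_poly_derivation:
  assumes D: "D \<in> derivations {} (UNIV :: 'a::idom set)"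
  shows "pderiv (map_poly D p) = map_poly D (pderiv p)"
proof (rule poly_eqI)
  fix n
  have "D (of_nat (Suc n) * x) = of_nat (Suc n) * D x" for x
    unfolding derivation_simps(2)[OF D] derivation_of_nat[OF D] by simp
  then show "coeff (pderiv (map_poly D p)) n = coeff (map_poly D (pderiv p)) n"
    by (simp only: coeff_pderiv coeff_map_poly derivation_simps[OF D])
qed

lemma d_derivation:
  "d1 \<in> derivations {} UNIV" "d2 \<in> derivations {} UNIV" "d3 \<in> derivations {} UNIV"
  unfolding d1_def d2_def d3_def by (intro map_poly_derivation pderiv_derivation)+

lemmas d_simps = d_derivation[THEN derivation_simps(1)] d_derivation[THEN derivation_simps(2)]
  d_derivation[THEN derivation_simps(3)] d_derivation[THEN derivation_simps(6)]

lemma d_commute: "d2 (d1 p) = d1 (d2 p)" "d3 (d1 p) = d1 (d3 p)" "d3 (d2 p) = d2 (d3 p)"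
proof -
  note m = map_poly_derivation[OF pderiv_derivation]
  show "d2 (d1 p) = d1 (d2 p)" "d3 (d1 p) = d1 (d3 p)"
    unfolding d1_def d2_def d3_def
    by (rule pderiv_map_poly_derivation[symmetric] m pderiv_derivation)+
  show "d3 (d2 p) = d2 (d3 p)"
    unfolding d2_def d3_def
    by (rule poly_eqI) (simp add: coeff_map_poly pderiv_map_poly_derivation[OF pderiv_derivation])
qed

lemma d_coeff:
  "d1 [:f:] = 0" "d2 [:f:] = [:pderiv f:]" "d3 [:f:] = [:map_poly pderiv f:]"
  "map_poly pderiv [:g:] = [:pderiv g:]"
  by (simp_all add: d1_def d2_def d3_def map_poly_pCons)

lemma d_const3: "d1 (const3 c) = 0" "d2 (const3 c) = 0" "d3 (const3 c) = 0"
  by (simp_all add: const3_def d_coeff)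

lemma const3_simps:
  "const3 0 = 0" "const3 1 = 1" "const3 (x + y) = const3 x + const3 y"
  "const3 (x * y) = const3 x * const3 y" "const3 (- x) = - const3 x"
  by (simp_all add: const3_def one_pCons)

section \<open>Polynomials with coefficients in a subring\<close>

lemma subring_polys_over:
  assumes "subring_set A"
  shows "subring_set (polys_over A)"
  unfolding subring_set_def polys_over_def
  by (auto simp: coeff_mult subring_setD[OF assms] coeff_1 intro!: subring_set_sum[OF assms])

lemma pCons_polys_over: "subring_set A \<Longrightarrow> c \<in> A \<Longrightarrow> [:c:] \<in> polys_over A"
  by (auto simp: polys_over_def coeff_pCons subring_setD split: nat.split)

lemma pderiv_polys_over: "subring_set A \<Longrightarrow> p \<in> polys_over A \<Longrightarrow> pderiv p \<in> polys_over A"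
  unfolding polys_over_def by (auto simp: coeff_pderiv subring_setD simp del: of_nat_Suc)

lemma map_poly_polys_over:
  "D 0 = 0 \<Longrightarrow> (\<And>x. x \<in> A \<Longrightarrow> D x \<in> A) \<Longrightarrow> p \<in> polys_over A \<Longrightarrow> map_poly D p \<in> polys_over A"
  unfolding polys_over_def by (auto simp: coeff_map_poly)

text \<open>The value 0 off the polynomials over \<open>F\<close> follows the convention in
  \<open>derivations\<close>, so that equality of fields is equality of functions.\<close>

definition triangular_field ::
  "'a::field set \<Rightarrow> 'a poly poly \<Rightarrow> 'a poly \<Rightarrow> 'a \<Rightarrow> 'a poly3 \<Rightarrow> 'a poly3" where
  "triangular_field F f g c = (\<lambda>p. if p \<in> polys3_over F
     then [:f:] * d1 p + [:[:g:]:] * d2 p + const3 c * d3 p else 0)"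

text \<open>All indices from 2 on give the last variable, so a condition for all \<open>k\<close> is
  a condition on the three variables.\<close>

definition var3 :: "nat \<Rightarrow> 'a::field poly3" where
  "var3 k = (if k = 0 then [:0, 1:] else if k = 1 then [:[:0, 1:]:] else [:[:[:0, 1:]:]:])"

context
  fixes F :: "'a::field set"
  assumes F: "subring_set F"
begin

lemmas rings = F subring_polys_over[OF F] subring_polys_over[OF subring_polys_over[OF F]]
  subring_polys_over[OF subring_polys_over[OF subring_polys_over[OF F]]]

lemmas polys3_closed = subring_setD[OF rings(4)]

lemma polys3_closed_d:
  assumes "p \<in> polys3_over F"
  shows "d1 p \<in> polys3_over F" "d2 p \<in> polys3_over F" "d3 p \<in> polys3_over F"
  using assms unfolding d1_def d2_def d3_def
  by (auto intro!: map_poly_polys_over pderiv_polys_over rings)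

lemma var3_polys3: "var3 k \<in> polys3_over F"
  using subring_setD(1,2)[OF F]
  by (auto simp: var3_def polys_over_def coeff_pCons split: nat.split)

text \<open>Reading the coefficients off the values at the variables gives both their uniqueness and
  the functionals that prove finite dimension.\<close>

lemma triangular_field_var3:
  "triangular_field F f g c (var3 0) = [:f:]"
  "triangular_field F f g c (var3 1) = [:[:g:]:]"
  "triangular_field F f g c (var3 2) = const3 c"
  unfolding triangular_field_def if_P[OF var3_polys3]
  by (simp_all add: var3_def d1_def d2_def d3_def map_poly_pCons pderiv_pCons pCons_one map_poly_1)

lemma triangular_field_inject:
  "triangular_field F f g c = triangular_field F f' g' c' \<longleftrightarrow> f = f' \<and> g = g' \<and> c = c'"
proof
  assume "triangular_field F f g c = triangular_field F f' g' c'"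
  then have "triangular_field F f g c (var3 k) = triangular_field F f' g' c' (var3 k)" for k
    by simp
  from this[of 0] this[of 1] this[of 2] show "f = f' \<and> g = g' \<and> c = c'"
    unfolding triangular_field_var3 by (simp add: const3_def)
qed simp

lemma triangular_field_closed:
  assumes "f \<in> polys_over (polys_over F)" "g \<in> polys_over F" "c \<in> F" "p \<in> polys3_over F"
  shows "triangular_field F f g c p \<in> polys3_over F"
  unfolding triangular_field_def const3_def if_P[OF assms(4)]
  by (intro polys3_closed pCons_polys_over rings polys3_closed_d assms)

lemma triangular_field_u3:
  assumes "f \<in> polys_over (polys_over F)" "g \<in> polys_over F" "c \<in> F"
  shows "triangular_field F f g c \<in> u3 F"
proof -
  have "const3 r \<in> polys3_over F" if "r \<in> F" for r
    unfolding const3_def by (intro pCons_polys_over rings that)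
  then have "triangular_field F f g c \<in> derivations (const3 ` F) (polys3_over F)"
    unfolding derivations_def using triangular_field_closed[OF assms]
    by (auto simp: polys3_closed triangular_field_def d_simps d_const3 algebra_simps
        simp del: mult_pCons_left mult_pCons_right)
  then show ?thesis unfolding u3_def using assms by (auto simp: triangular_field_def)
qed

lemma triangular_field_add:
  "(\<lambda>p. triangular_field F f g c p + triangular_field F f' g' c' p) =
     triangular_field F (f + f') (g + g') (c + c')"
proof
  fix p
  have "[:f + f':] = [:f:] + [:f':]" "[:[:g + g':]:] = [:[:g:]:] + [:[:g':]:]" by simp_all
  then show "triangular_field F f g c p + triangular_field F f' g' c' p =
    triangular_field F (f + f') (g + g') (c + c') p"
    by (simp only: triangular_field_def const3_simps split: if_split) (simp only: algebra_simps; simp)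
qed

lemma triangular_field_scale:
  "(\<lambda>p. const3 r * triangular_field F f g c p) =
     triangular_field F ([:[:r:]:] * f) ([:r:] * g) (r * c)"
proof
  fix p
  have e: "[:[:[:r:]:] * f:] = const3 r * [:f:]" "[:[:[:r:] * g:]:] = const3 r * [:[:g:]:]"
    by (simp_all add: const3_def)
  show "const3 r * triangular_field F f g c p =
    triangular_field F ([:[:r:]:] * f) ([:r:] * g) (r * c) p"
    unfolding triangular_field_def e const3_simps by (simp add: algebra_simps del: mult_pCons_left)
qed

text \<open>The second-order terms cancel by \<open>d_commute\<close>. On coefficients in x2 and x3,
  \<open>pderiv\<close> is the derivative in x2 and \<open>map_poly pderiv\<close> the one in
  x3.\<close>

lemma triangular_field_bracket:
  assumes f: "f \<in> polys_over (polys_over F)" "g \<in> polys_over F" "c \<in> F"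
    and f': "f' \<in> polys_over (polys_over F)" "g' \<in> polys_over F" "c' \<in> F"
  shows "lie_bracket (triangular_field F f g c) (triangular_field F f' g' c') =
    triangular_field F
      ([:g:] * pderiv f' + [:[:c:]:] * map_poly pderiv f' -
        ([:g':] * pderiv f + [:[:c':]:] * map_poly pderiv f))
      ([:c:] * pderiv g' - [:c':] * pderiv g) 0"
proof
  fix p
  show "lie_bracket (triangular_field F f g c) (triangular_field F f' g' c') p =
    triangular_field F
      ([:g:] * pderiv f' + [:[:c:]:] * map_poly pderiv f' -
        ([:g':] * pderiv f + [:[:c':]:] * map_poly pderiv f))
      ([:c:] * pderiv g' - [:c':] * pderiv g) 0 p"
  proof (cases "p \<in> polys3_over F")
    case True
    define X where "X f g c p = [:f:] * d1 p + [:[:g:]:] * d2 p + const3 c * d3 p"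
      for f :: "'a poly poly" and g c p
    have t: "triangular_field F f g c q = X f g c q" if "q \<in> polys3_over F" for f g c q
      using that by (simp add: triangular_field_def X_def)
    have e: "[:[:g:] * pderiv f' + [:[:c:]:] * map_poly pderiv f' -
        ([:g':] * pderiv f + [:[:c':]:] * map_poly pderiv f):] =
        [:[:g:]:] * d2 [:f':] + const3 c * d3 [:f':] - ([:[:g':]:] * d2 [:f:] + const3 c' * d3 [:f:])"
      "[:[:[:c:] * pderiv g' - [:c':] * pderiv g:]:] = const3 c * d3 [:[:g':]:] - const3 c' * d3 [:[:g:]:]"
      by (simp_all add: d_coeff const3_def)
    have z: "d1 [:[:g:]:] = 0" "d2 [:[:g:]:] = 0" for g :: "'a poly" by (simp_all add: d_coeff)
    have "lie_bracket (triangular_field F f g c) (triangular_field F f' g' c') p =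
      X f g c (X f' g' c' p) - X f' g' c' (X f g c p)"
      unfolding lie_bracket_def
      using t triangular_field_closed[OF f True] triangular_field_closed[OF f' True] True by simp
    also have "\<dots> = X ([:g:] * pderiv f' + [:[:c:]:] * map_poly pderiv f' -
        ([:g':] * pderiv f + [:[:c':]:] * map_poly pderiv f))
      ([:c:] * pderiv g' - [:c':] * pderiv g) 0 p"
      unfolding X_def e d_simps d_const3 d_commute d_coeff(1) z const3_simps(1)
      by (simp only: algebra_simps mult_zero_left add_0)
    finally show ?thesis using t True by simp
  qed (simp add: triangular_field_def lie_bracket_def d_simps)
qed

lemma fin_dim_triangular_fields:
  assumes inv: "\<And>x. x \<in> F \<Longrightarrow> inverse x \<in> F"
    and M: "(\<lambda>_. 0) \<in> M" "\<And>D E. D \<in> M \<Longrightarrow> E \<in> M \<Longrightarrow> (\<lambda>p. D p + E p) \<in> M"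
      "\<And>r D. r \<in> F \<Longrightarrow> D \<in> M \<Longrightarrow> (\<lambda>p. const3 r * D p) \<in> M"
    and bounded: "\<And>D. D \<in> M \<Longrightarrow> \<exists>f g c. D = triangular_field F f g c \<and>
      f \<in> polys_over (polys_over F) \<and> g \<in> polys_over F \<and> c \<in> F \<and>
      (\<forall>i j. i \<ge> n \<or> j \<ge> n \<longrightarrow> coeff (coeff f i) j = 0) \<and> (\<forall>j\<ge>n. coeff g j = 0)"
  shows "fin_dim_over (const3 ` F) M"
proof -
  \<comment> \<open>The coefficient of the monomial with exponents \<open>i\<close> in x2 and
    \<open>j\<close> in x3 in the value at a variable; x1 does not occur there, hence the index 0.
    The uniform degree bound \<open>n\<close> leaves finitely many of these functionals to be
    tested.\<close>
  define l where "l = (\<lambda>(k, i, j) (D :: 'a poly3 \<Rightarrow> 'a poly3). coeff (coeff (coeff (D (var3 k)) 0) i) j)"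
  show ?thesis
  proof (rule fin_dim_over_functionals[where I = "{..<3} \<times> {..n} \<times> {..n}" and l = l])
    fix x D assume x: "x \<in> {..<3::nat} \<times> {..n} \<times> {..n}" and D: "D \<in> M"
    obtain k i j where x: "x = (k, i, j)" by (cases x)
    from bounded[OF D] obtain f g c where "D = triangular_field F f g c"
      "f \<in> polys_over (polys_over F)" "g \<in> polys_over F" "c \<in> F" by blast
    then have "D (var3 k) \<in> polys3_over F" by (simp add: triangular_field_closed var3_polys3)
    then show "l x D \<in> F" by (simp add: l_def x polys_over_def)
  next
    fix x r D
    show "l x (\<lambda>p. const3 r * D p) = r * l x D"
      by (cases x) (simp add: l_def const3_def)
  next
    fix D assume D: "D \<in> M" and z: "\<And>x. x \<in> {..<3} \<times> {..n} \<times> {..n} \<Longrightarrow> l x D = 0"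
    from bounded[OF D] obtain f g c where D: "D = triangular_field F f g c"
      and b: "\<And>i j. i \<ge> n \<or> j \<ge> n \<Longrightarrow> coeff (coeff f i) j = 0" "\<And>j. j \<ge> n \<Longrightarrow> coeff g j = 0"
      by blast
    have "coeff (coeff f i) j = 0" for i j
      using z[of "(0, i, j)"] b(1)[of i j] by (cases "i \<ge> n \<or> j \<ge> n")
        (auto simp: l_def D triangular_field_var3)
    then have "f = 0" by (intro poly_eqI) simp
    moreover have "coeff g j = 0" for j
      using z[of "(1, 0, j)"] b(2)[of j] triangular_field_var3(2)[of f g c] by (cases "j \<ge> n") (auto simp: l_def D)
    then have "g = 0" by (intro poly_eqI) simp
    moreover have "c = 0" using z[of "(2, 0, 0)"] by (simp add: l_def D triangular_field_var3 const3_def)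
    ultimately show "D = (\<lambda>_. 0)" by (auto simp: D triangular_field_def const3_simps)
  qed (use F inv M in \<open>auto simp: const3_simps l_def\<close>)
qed

end

text \<open>Termwise integration in x2. The coefficients stay over \<open>F\<close> because a
  subring closed under inverses contains the inverse of every integer.\<close>

lemma ex_antiderivative:
  fixes P :: "'a::field_char_0 poly poly"
  assumes F: "subring_set F" "\<And>x. x \<in> F \<Longrightarrow> inverse x \<in> F" and P: "P \<in> polys_over (polys_over F)"
  shows "\<exists>h\<in>polys_over (polys_over F). pderiv h = P"
proof -
  define c where "c i = (case i of 0 \<Rightarrow> 0 | Suc k \<Rightarrow> smult (inverse (of_nat (Suc k))) (coeff P k))" for i
  define h where "h = Abs_poly c"
  have h: "coeff h i = c i" for i
    unfolding h_def
    by (subst coeff_Abs_poly[where n = "Suc (degree P)"]) (auto simp: c_def coeff_eq_0 split: nat.split)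
  have "pderiv h = P"
    by (rule poly_eqI) (simp add: coeff_pderiv h c_def of_nat_poly del: of_nat_Suc)
  moreover have "c i \<in> polys_over F" for i
    using P subring_setD[OF F(1)] F(2) unfolding c_def polys_over_def
    by (auto split: nat.split simp del: of_nat_Suc)
  ultimately show ?thesis by (intro bexI[of _ h]) (auto simp: polys_over_def[of "polys_over F"] h)
qed

lemma poly2_bounded:
  fixes h :: "'a::zero poly poly"
  shows "\<exists>n. \<forall>i j. i \<ge> n \<or> j \<ge> n \<longrightarrow> coeff (coeff h i) j = 0"
proof -
  let ?n = "Suc (degree h + (\<Sum>i\<le>degree h. degree (coeff h i)))"
  have "coeff (coeff h i) j = 0" if "i \<ge> ?n \<or> j \<ge> ?n" for i j
  proof (cases "i \<le> degree h")
    case True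
    then have "degree (coeff h i) \<le> (\<Sum>i\<le>degree h. degree (coeff h i))"
      by (intro member_le_sum) auto
    then show ?thesis using that True by (intro coeff_eq_0) auto
  qed (simp add: coeff_eq_0)
  then show ?thesis by blast
qed

section \<open>Taylor expansion along a frame of derivations\<close>

text \<open>In characteristic zero vanishing partial derivatives leave only a constant. Identities
  between Taylor expansions are proved by this criterion.\<close>

lemma poly2_eq_zeroI:
  fixes p :: "'a::field_char_0 poly poly"
  assumes "pderiv p = 0" "map_poly pderiv p = 0" "coeff (coeff p 0) 0 = 0"
  shows "p = 0"
proof -
  have "degree p = 0" using assms(1) by (simp add: pderiv_eq_0_iff)
  then obtain q where p: "p = [:q:]" by (rule degree_eq_zeroE)
  then have "degree q = 0" using assms(2) by (simp add: map_poly_pCons pderiv_eq_0_iff)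
  then obtain r where "q = [:r:]" by (rule degree_eq_zeroE)
  then show ?thesis using p assms(3) by simp
qed

text \<open>Zero fields satisfy these axioms too, so one locale serves every rank.\<close>

locale derivation_frame =
  fixes D1 D2 D3 :: "'a::field_char_0 \<Rightarrow> 'a" and c :: 'a
  assumes der: "D1 \<in> derivations {} UNIV" "D2 \<in> derivations {} UNIV" "D3 \<in> derivations {} UNIV"
    and comm: "D1 (D2 p) = D2 (D1 p)" "D1 (D3 p) = D3 (D1 p)"
      "D3 (D2 p) = D2 (D3 p) + c * D1 p"
begin

lemmas der_simps = der[THEN derivation_simps(1)] der[THEN derivation_simps(2)]
  der[THEN derivation_simps(3)] der[THEN derivation_simps(4)]
  der[THEN derivation_simps(5)] der[THEN derivation_simps(6)]

section \<open>Constants and locally nilpotent elements\<close>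

definition const :: "'a set" where
  "const = {f. D1 f = 0 \<and> D2 f = 0 \<and> D3 f = 0}"

text \<open>Words of length \<open>n\<close> in \<open>D2\<close> and \<open>D3\<close> kill
  \<open>level n\<close>; the empty word gives \<open>level 0 = {0}\<close>. Thus \<open>n\<close>
  exceeds the total degree of the later Taylor expansion, and constants form level 1.\<close>

primrec level :: "nat \<Rightarrow> 'a set" where
  "level 0 = {0}"
| "level (Suc n) = {f. D1 f = 0 \<and> D2 f \<in> level n \<and> D3 f \<in> level n}"

definition nil_elems :: "'a set" where
  "nil_elems = (\<Union>n. level n)"

lemma level_1: "level (Suc 0) = const"
  by (simp add: const_def)

lemma zero_level: "0 \<in> level n"
  by (induction n) (simp_all add: der_simps)

lemma level_mono: "m \<le> n \<Longrightarrow> level m \<subseteq> level n"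
proof (induction m arbitrary: n)
  case (Suc m)
  then obtain k where "n = Suc k" "m \<le> k" by (metis Suc_le_D Suc_le_mono)
  then show ?case using Suc.IH[of k] by auto
qed (simp add: zero_level)

lemma level_add: "f \<in> level n \<Longrightarrow> g \<in> level n \<Longrightarrow> f + g \<in> level n"
  by (induction n arbitrary: f g) (simp_all add: der_simps)

lemma level_diff: "f \<in> level n \<Longrightarrow> g \<in> level n \<Longrightarrow> f - g \<in> level n"
  by (induction n arbitrary: f g) (simp_all add: der_simps)

lemma level_const: "r \<in> const \<Longrightarrow> f \<in> level n \<Longrightarrow> r * f \<in> level n"
  by (induction n arbitrary: f) (simp_all add: der_simps const_def)

text \<open>By the Leibniz rule one letter lowers the level of one of the two factors.\<close>

lemma level_mult: "f \<in> level n \<Longrightarrow> g \<in> level m \<Longrightarrow> f * g \<in> level (n + m)"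
proof (induction "n + m" arbitrary: n m f g rule: less_induct)
  case less
  show ?case
  proof (cases "n = 0 \<or> m = 0")
    case True
    then show ?thesis using less.prems by (auto simp: zero_level)
  next
    case False
    then obtain n' m' where n: "n = Suc n'" and m: "m = Suc m'" by (metis not0_implies_Suc)
    have "D f * g + f * D g \<in> level (n' + m)" if "D f \<in> level n'" "D g \<in> level m'" for D
      using less.hyps[OF _ that(1) less.prems(2)] less.hyps[OF _ less.prems(1) that(2)]
      by (intro level_add) (simp_all add: n m)
    from this[of D2] this[of D3] have "D2 (f * g) \<in> level (n' + m)" "D3 (f * g) \<in> level (n' + m)"
      using less.prems by (auto simp: n m der_simps)
    moreover have "D1 (f * g) = 0" using less.prems by (simp add: n m der_simps)
    ultimately show ?thesis by (simp add: n)
  qed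
qed

text \<open>Truncated subtraction is harmless at \<open>n = 0\<close>, where \<open>f\<close> is
  zero; iteration then needs no case distinction.\<close>

lemma level_D:
  assumes "f \<in> level n"
  shows "D1 f = 0" "D2 f \<in> level (n - 1)" "D3 f \<in> level (n - 1)" "D2 f \<in> level n" "D3 f \<in> level n"
proof -
  show *: "D1 f = 0" "D2 f \<in> level (n - 1)" "D3 f \<in> level (n - 1)"
    using assms by (cases n; simp add: der_simps)+
  show "D2 f \<in> level n" "D3 f \<in> level n" using level_mono[of "n - 1" n] * by auto
qed

lemma const_subring: "subring_set const"
  by (auto simp: subring_set_def const_def der_simps)

lemma const_inverse: "x \<in> const \<Longrightarrow> inverse x \<in> const"
  by (simp add: const_def derivation_inverse[OF der(1)] derivation_inverse[OF der(2)]
      derivation_inverse[OF der(3)])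

lemma nil_elemsI: "f \<in> level n \<Longrightarrow> f \<in> nil_elems"
  by (auto simp: nil_elems_def)

lemma nil_elemsE:
  assumes "f \<in> nil_elems" obtains n where "f \<in> level n"
  using assms by (auto simp: nil_elems_def)

lemma const_nil: "const \<subseteq> nil_elems"
  using nil_elemsI[of _ "Suc 0"] unfolding level_1 by blast

lemma nil_elems_add: "f \<in> nil_elems \<Longrightarrow> g \<in> nil_elems \<Longrightarrow> f + g \<in> nil_elems"
proof -
  assume "f \<in> nil_elems" "g \<in> nil_elems"
  then obtain n m where "f \<in> level n" "g \<in> level m" by (auto simp: nil_elems_def)
  then have "f \<in> level (n + m)" "g \<in> level (n + m)"
    using level_mono[of n "n + m"] level_mono[of m "n + m"] by auto
  then show ?thesis by (intro nil_elemsI level_add)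
qed

lemma nil_elems_mult: "f \<in> nil_elems \<Longrightarrow> g \<in> nil_elems \<Longrightarrow> f * g \<in> nil_elems"
  by (elim nil_elemsE) (rule nil_elemsI, rule level_mult)

lemma nil_elems_subring: "subring_set nil_elems"
proof -
  have "- f \<in> nil_elems" if "f \<in> nil_elems" for f
    using that level_diff[OF zero_level] by (auto simp: nil_elems_def)
  then show ?thesis
    using nil_elems_add nil_elems_mult subring_setD(1,2)[OF const_subring] const_nil
    by (auto simp: subring_set_def)
qed

lemma const_of_nat: "of_nat n \<in> const" "inverse (of_nat n) \<in> const"
  using subring_setD(7)[OF const_subring] const_inverse by auto

lemma nil_elems_D:
  assumes "f \<in> nil_elems"
  shows "D1 f = 0" "D2 f \<in> nil_elems" "D3 f \<in> nil_elems" "D3 (D2 f) = D2 (D3 f)"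
proof -
  obtain n where "f \<in> level n" using assms by (rule nil_elemsE)
  then show *: "D1 f = 0" "D2 f \<in> nil_elems" "D3 f \<in> nil_elems"
    by (auto intro: nil_elemsI dest: level_D)
  show "D3 (D2 f) = D2 (D3 f)" by (simp add: comm(3) *)
qed

lemma funpow_level: "f \<in> level n \<Longrightarrow> (D2 ^^ i) ((D3 ^^ j) f) \<in> level (n - j - i)"
proof -
  assume f: "f \<in> level n"
  have 3: "(D3 ^^ j) f \<in> level (n - j)"
  proof (induction j)
    case (Suc j) then show ?case using level_D(3)[OF Suc] by simp
  qed (simp add: f)
  show ?thesis
  proof (induction i)
    case (Suc i) then show ?case using level_D(2)[OF Suc] by simp
  qed (simp add: 3)
qed

lemma funpow_D2_zero: "f \<in> nil_elems \<Longrightarrow> \<exists>n. (D2 ^^ n) f = 0"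
proof (elim nil_elemsE)
  fix n assume "f \<in> level n"
  then show ?thesis using funpow_level[of f n n 0] by auto
qed

lemma funpow_D3_zero: "f \<in> nil_elems \<Longrightarrow> \<exists>n. (D3 ^^ n) f = 0"
proof (elim nil_elemsE)
  fix n assume "f \<in> level n"
  then show ?thesis using funpow_level[of f n 0 n] by auto
qed

text \<open>
  An element of least level among those of \<open>B\<close> not killed by \<open>D\<close> has a constant derivative, so
  it can be scaled to a slice.
\<close>

lemma ex_slice:
  assumes D: "D \<in> derivations {} UNIV"
    and B: "\<And>r f. r \<in> const \<Longrightarrow> f \<in> B \<Longrightarrow> r * f \<in> B"
      "\<And>f n. f \<in> B \<Longrightarrow> f \<in> level (Suc n) \<Longrightarrow> D f \<noteq> 0 \<Longrightarrow>
        (\<And>g. g \<in> B \<Longrightarrow> g \<in> level n \<Longrightarrow> D g = 0) \<Longrightarrow> D f \<in> const"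
    and Dc: "\<And>f. f \<in> const \<Longrightarrow> D f = 0"
    and f: "f \<in> B" "f \<in> nil_elems" "D f \<noteq> 0"
  shows "\<exists>y\<in>B. y \<in> nil_elems \<and> D y = 1"
proof -
  let ?P = "\<lambda>n. \<exists>f\<in>B. f \<in> level n \<and> D f \<noteq> 0"
  define n where "n = (LEAST n. ?P n)"
  have "\<exists>n. ?P n" using f nil_elemsE by blast
  then have "?P n" unfolding n_def by (rule LeastI_ex)
  moreover have "\<not> ?P m" if "m < n" for m using that unfolding n_def by (rule not_less_Least)
  ultimately obtain g where g: "g \<in> B" "g \<in> level n" "D g \<noteq> 0"
    and min: "\<And>m h. m < n \<Longrightarrow> h \<in> B \<Longrightarrow> h \<in> level m \<Longrightarrow> D h = 0" by blast
  obtain k where n: "n = Suc k"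
    using g by (cases n) (auto simp: derivation_simps(3)[OF D])
  have Dg: "D g \<in> const" using B(2)[of g k] g min[of k] n by auto
  define r where "r = inverse (D g)"
  have r: "r \<in> const" unfolding r_def by (rule const_inverse[OF Dg])
  have "D (r * g) = 1" by (simp add: derivation_simps(2)[OF D] Dc[OF r]) (simp add: r_def g)
  moreover have "r * g \<in> nil_elems" using g r level_const nil_elemsI by blast
  ultimately show ?thesis using B(1)[OF r g(1)] by blast
qed

text \<open>Two projections are composed: from \<open>nil_elems\<close> along a slice of
  \<open>D2\<close> onto the kernel \<open>B\<close> of \<open>D2\<close>, and from \<open>B\<close>
  along a slice of \<open>D3\<close> onto the constants. The second makes sense because
  \<open>D3\<close> commutes with \<open>D2\<close> on \<open>nil_elems\<close> and so preserves
  \<open>B\<close>.\<close>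

lemma ex_retraction:
  "\<exists>e. (\<forall>f\<in>nil_elems. e f \<in> const) \<and> (\<forall>f\<in>const. e f = f) \<and>
     (\<forall>f\<in>nil_elems. \<forall>g\<in>nil_elems. e (f + g) = e f + e g \<and> e (f * g) = e f * e g)"
proof -
  note a = subring_setD[OF nil_elems_subring]
  have div: "f / of_nat n \<in> nil_elems" if "f \<in> nil_elems" for f n
    using const_of_nat(2)[of n] const_nil a(5)[OF that] by (auto simp: divide_inverse)
  define R where "R A D e \<longleftrightarrow> (\<forall>f\<in>A. e f \<in> A \<and> D (e f) = 0) \<and> (\<forall>f\<in>A. D f = 0 \<longrightarrow> e f = f) \<and>
     (\<forall>f\<in>A. \<forall>g\<in>A. e (f + g) = e f + e g) \<and> (\<forall>f\<in>A. \<forall>g\<in>A. e (f * g) = e f * e g)"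
    for A :: "'a set" and D e :: "'a \<Rightarrow> 'a"
  have "\<exists>e. R nil_elems D2 e"
  proof (cases "\<exists>f\<in>nil_elems. D2 f \<noteq> 0")
    case True
    then obtain f where f: "f \<in> nil_elems" "D2 f \<noteq> 0" by blast
    have "\<exists>y\<in>nil_elems. y \<in> nil_elems \<and> D2 y = 1"
    proof (rule ex_slice[OF der(2) _ _ _ f(1) f])
      \<comment> \<open>Both \<open>D2 f\<close> and \<open>D3 f\<close> have smaller level, so
        minimality lets \<open>D2\<close> kill them; as \<open>D2\<close> and \<open>D3\<close>
        commute here, \<open>D2 f\<close> is killed by \<open>D3\<close> as well.\<close>
      fix f n assume h: "f \<in> nil_elems" "f \<in> level (Suc n)"
        "\<And>g. g \<in> nil_elems \<Longrightarrow> g \<in> level n \<Longrightarrow> D2 g = 0"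
      then have "D2 (D2 f) = 0" "D2 (D3 f) = 0" using nil_elems_D[of f] by auto
      then show "D2 f \<in> const" using nil_elems_D[OF h(1)] nil_elems_D[OF nil_elems_D(2)[OF h(1)]]
        by (simp add: const_def)
    qed (use const_nil nil_elems_mult in \<open>auto simp: const_def\<close>)
    then obtain y where y: "y \<in> nil_elems" "D2 y = 1" by blast
    show ?thesis unfolding R_def
      by (rule slice_retraction[OF der(2) nil_elems_subring div nil_elems_D(2) funpow_D2_zero y])
  next
    case False
    \<comment> \<open>A derivation that vanishes on the ring has no slice, but its kernel is
      everything and the identity is the projection.\<close>
    then show ?thesis by (intro exI[of _ id]) (simp add: R_def)
  qed
  then obtain e2 where e2: "R nil_elems D2 e2" by blast
  define B where "B = {f \<in> nil_elems. D2 f = 0}"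
  have B: "subring_set B"
    using a by (auto simp: subring_set_def B_def der_simps)
  have c2: "D2 r = 0" if "r \<in> const" for r using that by (simp add: const_def)
  have Bdiv: "f / of_nat n \<in> B" if "f \<in> B" for f n
    using that div[of f n] by (simp add: B_def divide_inverse der_simps c2[OF const_of_nat(2)])
  have "\<exists>e. R B D3 e"
  proof (cases "\<exists>f\<in>B. D3 f \<noteq> 0")
    case True
    then obtain f where f: "f \<in> B" "D3 f \<noteq> 0" by blast
    then have "f \<in> nil_elems" by (simp add: B_def)
    have "\<exists>y\<in>B. y \<in> nil_elems \<and> D3 y = 1"
    proof (rule ex_slice[OF der(3) _ _ _ f(1) \<open>f \<in> nil_elems\<close> f(2)])
      fix f n assume h: "f \<in> B" "f \<in> level (Suc n)"
        "\<And>g. g \<in> B \<Longrightarrow> g \<in> level n \<Longrightarrow> D3 g = 0"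
      have f: "f \<in> nil_elems" "D2 f = 0" using h(1) by (auto simp: B_def)
      have D: "D2 (D3 f) = 0" using nil_elems_D(4)[OF f(1)] f(2) by (simp add: der_simps)
      then have "D3 f \<in> B" using nil_elems_D[OF f(1)] by (simp add: B_def)
      then have "D3 (D3 f) = 0" using h by auto
      then show "D3 f \<in> const" using D nil_elems_D(1)[OF nil_elems_D(3)[OF f(1)]]
        by (simp add: const_def)
    next
      fix r f assume "r \<in> const" "f \<in> B"
      then show "r * f \<in> B" using nil_elems_mult[of r f] const_nil c2[of r]
        by (auto simp: B_def der_simps)
    qed (auto simp: const_def)
    then obtain y where y: "y \<in> B" "D3 y = 1" by blast
    show ?thesis unfolding R_def
    proof (rule slice_retraction[OF der(3) B Bdiv _ _ y])
      fix f assume f: "f \<in> B"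
      then show "D3 f \<in> B" using nil_elems_D[of f] by (simp add: B_def der_simps)
      show "\<exists>n. (D3 ^^ n) f = 0" using f funpow_D3_zero by (simp add: B_def)
    qed
  next
    case False
    then show ?thesis by (intro exI[of _ id]) (simp add: R_def)
  qed
  then obtain e3 where e3: "R B D3 e3" by blast
  have 2: "e2 f \<in> B" if "f \<in> nil_elems" for f
    using e2 that by (simp add: R_def B_def)
  have 3: "e3 f \<in> const" if "f \<in> B" for f
    using e3 that nil_elems_D(1) by (auto simp: R_def B_def const_def)
  have "e3 (e2 f) = f" if "f \<in> const" for f
  proof -
    have "e2 f = f" using e2 that const_nil c2[OF that] unfolding R_def by blast
    moreover have "f \<in> B" "D3 f = 0" using that const_nil by (auto simp: B_def const_def)
    then have "e3 f = f" using e3 unfolding R_def by blast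
    ultimately show ?thesis by simp
  qed
  moreover have "e3 (e2 (f + g)) = e3 (e2 f) + e3 (e2 g) \<and> e3 (e2 (f * g)) = e3 (e2 f) * e3 (e2 g)"
    if "f \<in> nil_elems" "g \<in> nil_elems" for f g
  proof -
    have "e2 (f + g) = e2 f + e2 g" "e2 (f * g) = e2 f * e2 g" using e2 that unfolding R_def by blast+
    then show ?thesis using e3 2[OF that(1)] 2[OF that(2)] unfolding R_def by simp
  qed
  ultimately show ?thesis using 2 3 by (intro exI[of _ "e3 \<circ> e2"]) simp
qed

section \<open>Taylor expansion at the point given by the retraction\<close>

definition retr :: "'a \<Rightarrow> 'a" where
  "retr = (SOME e. (\<forall>f\<in>nil_elems. e f \<in> const) \<and> (\<forall>f\<in>const. e f = f) \<and>
     (\<forall>f\<in>nil_elems. \<forall>g\<in>nil_elems. e (f + g) = e f + e g \<and> e (f * g) = e f * e g))"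

lemma retr:
  "f \<in> nil_elems \<Longrightarrow> retr f \<in> const" "f \<in> const \<Longrightarrow> retr f = f"
  "f \<in> nil_elems \<Longrightarrow> g \<in> nil_elems \<Longrightarrow> retr (f + g) = retr f + retr g"
  "f \<in> nil_elems \<Longrightarrow> g \<in> nil_elems \<Longrightarrow> retr (f * g) = retr f * retr g"
  using someI_ex[OF ex_retraction, folded retr_def] by simp_all

text \<open>\<open>retr\<close> applied to the coefficients of exp(x2 D2 + x3 D3) f, with x2 as
  outer and x3 as inner variable. On \<open>nil_elems\<close> the coefficient sequences are finite,
  so \<open>Abs_poly\<close> is meaningful there.\<close>

definition taylor :: "'a \<Rightarrow> 'a poly poly" where
  "taylor f =
     Abs_poly (\<lambda>i. Abs_poly (\<lambda>j. retr ((D2 ^^ i) ((D3 ^^ j) f)) / (fact i * fact j)))"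

lemma retr_zero: "retr 0 = 0"
  using retr(2) subring_setD(1)[OF const_subring] by blast

lemma retr_level_zero:
  assumes "f \<in> level n" "i \<ge> n \<or> j \<ge> n"
  shows "retr ((D2 ^^ i) ((D3 ^^ j) f)) = 0"
proof -
  have "n - j - i = 0" using assms(2) by auto
  then show ?thesis using funpow_level[OF assms(1), of i j] retr_zero by simp
qed

lemma coeff_taylor:
  assumes "f \<in> nil_elems"
  shows "coeff (coeff (taylor f) i) j = retr ((D2 ^^ i) ((D3 ^^ j) f)) / (fact i * fact j)"
proof -
  obtain n where n: "f \<in> level n" using assms by (rule nil_elemsE)
  define q where "q i = Abs_poly (\<lambda>j. retr ((D2 ^^ i) ((D3 ^^ j) f)) / (fact i * fact j))" for i
  have q: "coeff (q i) = (\<lambda>j. retr ((D2 ^^ i) ((D3 ^^ j) f)) / (fact i * fact j))" for i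
    unfolding q_def by (rule coeff_Abs_poly[where n = n]) (simp add: retr_level_zero[OF n])
  have "coeff (taylor f) = q"
    unfolding taylor_def q_def[symmetric]
    by (rule coeff_Abs_poly[where n = n]) (simp add: poly_eq_iff q retr_level_zero[OF n])
  then show ?thesis by (simp add: q)
qed

lemma taylor_level:
  assumes "f \<in> level n" "i \<ge> n \<or> j \<ge> n"
  shows "coeff (coeff (taylor f) i) j = 0"
  using coeff_taylor[OF nil_elemsI[OF assms(1)]] retr_level_zero[OF assms] by simp

lemma funpow_nil_elems: "f \<in> nil_elems \<Longrightarrow> (D2 ^^ i) ((D3 ^^ j) f) \<in> nil_elems"
  using funpow_level nil_elemsI by (elim nil_elemsE) blast

lemma funpow_add:
  "(D2 ^^ i) ((D3 ^^ j) (f + g)) = (D2 ^^ i) ((D3 ^^ j) f) + (D2 ^^ i) ((D3 ^^ j) g)"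
proof -
  have "(D3 ^^ j) (f + g) = (D3 ^^ j) f + (D3 ^^ j) g" by (induction j) (simp_all add: der_simps)
  moreover have "(D2 ^^ i) (f + g) = (D2 ^^ i) f + (D2 ^^ i) g" for f g
    by (induction i) (simp_all add: der_simps)
  ultimately show ?thesis by simp
qed

lemma taylor_add:
  assumes "f \<in> nil_elems" "g \<in> nil_elems"
  shows "taylor (f + g) = taylor f + taylor g"
  by (intro poly_eqI)
    (simp only: coeff_add coeff_taylor[OF assms(1)] coeff_taylor[OF assms(2)]
      coeff_taylor[OF nil_elems_add[OF assms]] funpow_add
      retr(3)[OF funpow_nil_elems[OF assms(1)] funpow_nil_elems[OF assms(2)]] add_divide_distrib)

lemma taylor_zero: "taylor 0 = 0"
  using taylor_add[of 0 0] subring_setD(1)[OF nil_elems_subring]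
  by (simp only: add_0_left add_cancel_right_right)

lemma taylor_diff:
  assumes "f \<in> nil_elems" "g \<in> nil_elems"
  shows "taylor (f - g) = taylor f - taylor g"
  using taylor_add[OF subring_setD(6)[OF nil_elems_subring assms] assms(2)]
  by (simp only: diff_add_cancel add_diff_cancel_right')

lemma pderiv_taylor:
  assumes f: "f \<in> nil_elems"
  shows "pderiv (taylor f) = taylor (D2 f)"
proof (rule poly_eqI, rule poly_eqI)
  fix i j
  have "(D3 ^^ j) f \<in> nil_elems" for j using funpow_nil_elems[OF f, of 0 j] by simp
  \<comment> \<open>In the coefficients \<open>D3\<close> is applied first, so \<open>D2\<close> has
    to be moved past its powers; this uses that the two commute on \<open>nil_elems\<close>.\<close>
  then have "D2 ((D3 ^^ j) f) = (D3 ^^ j) (D2 f)"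
    by (induction j) (simp_all add: nil_elems_D(4)[symmetric])
  then have "(D2 ^^ Suc i) ((D3 ^^ j) f) = (D2 ^^ i) ((D3 ^^ j) (D2 f))"
    by (simp only: funpow_Suc_right o_apply)
  then show "coeff (coeff (pderiv (taylor f)) i) j = coeff (coeff (taylor (D2 f)) i) j"
    by (simp add: coeff_pderiv of_nat_poly coeff_taylor f nil_elems_D(2) divide_simps
        del: of_nat_Suc funpow.simps)
qed

lemma map_pderiv_taylor:
  assumes f: "f \<in> nil_elems"
  shows "map_poly pderiv (taylor f) = taylor (D3 f)"
proof (rule poly_eqI, rule poly_eqI)
  fix i j
  have "(D3 ^^ Suc j) f = (D3 ^^ j) (D3 f)"
    by (simp only: funpow_Suc_right o_apply)
  then show "coeff (coeff (map_poly pderiv (taylor f)) i) j = coeff (coeff (taylor (D3 f)) i) j"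
    by (simp add: coeff_pderiv coeff_map_poly coeff_taylor f nil_elems_D(3) divide_simps
        del: of_nat_Suc funpow.simps)
qed

lemma taylor_const:
  assumes "r \<in> const"
  shows "taylor r = [:[:r:]:]"
proof -
  have r: "r \<in> nil_elems" "D2 r = 0" "D3 r = 0" using assms const_nil by (auto simp: const_def)
  have "taylor r - [:[:r:]:] = 0"
  proof (rule poly2_eq_zeroI)
    show "pderiv (taylor r - [:[:r:]:]) = 0"
      unfolding pderiv_diff pderiv_taylor[OF r(1)] by (simp add: r taylor_zero)
    show "map_poly pderiv (taylor r - [:[:r:]:]) = 0"
      unfolding derivation_simps(6)[OF map_poly_derivation[OF pderiv_derivation]]
        map_pderiv_taylor[OF r(1)] by (simp add: r taylor_zero map_poly_pCons)
    show "coeff (coeff (taylor r - [:[:r:]:]) 0) 0 = 0"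
      using coeff_taylor[OF r(1), of 0 0] retr(2)[OF assms] by simp
  qed
  then show ?thesis by simp
qed

text \<open>Both sides have the same derivatives by induction on the levels, and the same constant term.\<close>

lemma taylor_mult:
  assumes "f \<in> nil_elems" "g \<in> nil_elems"
  shows "taylor (f * g) = taylor f * taylor g"
proof -
  have "taylor (f * g) = taylor f * taylor g" if "f \<in> level n" "g \<in> level m" for n m
    using that
  proof (induction "n + m" arbitrary: n m f g rule: less_induct)
    case less
    show ?case
    proof (cases "n = 0 \<or> m = 0")
      case True
      then show ?thesis using less.prems by (auto simp: taylor_zero)
    next
      case False
      then have lt: "n - 1 + m < n + m" "n + (m - 1) < n + m" by auto
      note fg = nil_elemsI[OF less.prems(1)] nil_elemsI[OF less.prems(2)]
      note m = nil_elems_mult nil_elems_D(2,3) fg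
      note md = derivation_simps(2,6)[OF map_poly_derivation[OF pderiv_derivation]]
      have 2: "taylor (D2 f * g) = taylor (D2 f) * taylor g" "taylor (f * D2 g) = taylor f * taylor (D2 g)"
        and 3: "taylor (D3 f * g) = taylor (D3 f) * taylor g" "taylor (f * D3 g) = taylor f * taylor (D3 g)"
        using less.hyps[OF lt(1) level_D(2)[OF less.prems(1)] less.prems(2)]
          less.hyps[OF lt(1) level_D(3)[OF less.prems(1)] less.prems(2)]
          less.hyps[OF lt(2) less.prems(1) level_D(2)[OF less.prems(2)]]
          less.hyps[OF lt(2) less.prems(1) level_D(3)[OF less.prems(2)]]
        by auto
      have "taylor (f * g) - taylor f * taylor g = 0"
      proof (rule poly2_eq_zeroI)
        have "taylor (D2 (f * g)) = taylor (D2 f) * taylor g + taylor f * taylor (D2 g)"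
          unfolding der_simps 2[symmetric] by (intro taylor_add m)
        then show "pderiv (taylor (f * g) - taylor f * taylor g) = 0"
          by (simp add: pderiv_diff pderiv_mult pderiv_taylor m)
        have "taylor (D3 (f * g)) = taylor (D3 f) * taylor g + taylor f * taylor (D3 g)"
          unfolding der_simps 3[symmetric] by (intro taylor_add m)
        then show "map_poly pderiv (taylor (f * g) - taylor f * taylor g) = 0"
          by (simp add: md map_pderiv_taylor m)
        show "coeff (coeff (taylor (f * g) - taylor f * taylor g) 0) 0 = 0"
          by (simp add: coeff_mult coeff_taylor m retr(4))
      qed
      then show ?thesis by simp
    qed
  qed
  then show ?thesis using assms by (elim nil_elemsE) blast
qed

lemma taylor_polys_over: "f \<in> nil_elems \<Longrightarrow> taylor f \<in> polys_over (polys_over const)"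
proof -
  assume f: "f \<in> nil_elems"
  have "retr ((D2 ^^ i) ((D3 ^^ j) f)) / (fact i * fact j) \<in> const" for i j
    using subring_setD(5)[OF const_subring retr(1)[OF funpow_nil_elems[OF f]] const_of_nat(2)[of "fact i * fact j"]]
    by (simp add: divide_inverse)
  then show ?thesis by (simp add: polys_over_def coeff_taylor f)
qed

text \<open>The derivatives of \<open>f\<close> also expand to zero and have smaller level. By
  induction they vanish, so \<open>f\<close> is constant, and \<open>retr\<close> fixes
  constants.\<close>

lemma taylor_eq_zeroD:
  assumes "f \<in> nil_elems" "taylor f = 0"
  shows "f = 0"
proof -
  have "f = 0" if "f \<in> level n" "taylor f = 0" for n
    using that
  proof (induction n arbitrary: f)
    case (Suc n)
    note f = nil_elemsI[OF Suc.prems(1)]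
    have "D2 f \<in> level n" "D3 f \<in> level n" using Suc.prems by auto
    moreover have "taylor (D2 f) = 0" "taylor (D3 f) = 0"
      using Suc.prems(2) pderiv_taylor[OF f] map_pderiv_taylor[OF f] by auto
    ultimately have "f \<in> const" using Suc.IH Suc.prems(1) by (simp add: const_def)
    then show ?case using Suc.prems(2) taylor_const by simp
  qed simp
  then show ?thesis using assms by (elim nil_elemsE) blast
qed

end

section \<open>Lie algebras adapted to a frame\<close>

text \<open>\<open>G\<close> stands for FL. The assumption \<open>indep\<close> is linear
  independence, over the whole field, of those frame fields that do not vanish. One level
  \<open>m\<close> serves all of \<open>G\<close>; it becomes the degree bound behind finite
  dimension. If \<open>D1\<close> vanishes, its bracket relation does not determine
  \<open>c\<close>, which is then set to 0.\<close>

locale adapted_algebra = derivation_frame +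
  fixes G :: "('a \<Rightarrow> 'a) set" and m :: nat
  assumes c: "c \<in> nil_elems" "D1 = (\<lambda>_. 0) \<Longrightarrow> c = 0"
    and indep: "\<And>a1 a2 a3. (\<And>p. a1 * D1 p + a2 * D2 p + a3 * D3 p = 0) \<Longrightarrow>
      (D1 = (\<lambda>_. 0) \<Longrightarrow> a1 = 0) \<Longrightarrow> (D2 = (\<lambda>_. 0) \<Longrightarrow> a2 = 0) \<Longrightarrow> (D3 = (\<lambda>_. 0) \<Longrightarrow> a3 = 0) \<Longrightarrow>
      a1 = 0 \<and> a2 = 0 \<and> a3 = 0"
    and G_coords: "\<And>D. D \<in> G \<Longrightarrow> \<exists>a1 a2 a3. D = (\<lambda>p. a1 * D1 p + a2 * D2 p + a3 * D3 p) \<and>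
      (D1 = (\<lambda>_. 0) \<longrightarrow> a1 = 0) \<and> (D2 = (\<lambda>_. 0) \<longrightarrow> a2 = 0) \<and> (D3 = (\<lambda>_. 0) \<longrightarrow> a3 = 0) \<and>
      a1 \<in> level m \<and> a2 \<in> level m \<and> D2 a2 = 0 \<and> a3 \<in> const"
    and G_zero: "(\<lambda>_. 0) \<in> G"
    and G_add: "\<And>D E. D \<in> G \<Longrightarrow> E \<in> G \<Longrightarrow> (\<lambda>p. D p + E p) \<in> G"
    and G_scale: "\<And>r D. r \<in> const \<Longrightarrow> D \<in> G \<Longrightarrow> (\<lambda>p. r * D p) \<in> G"
    and G_bracket: "\<And>D E. D \<in> G \<Longrightarrow> E \<in> G \<Longrightarrow> lie_bracket D E \<in> G"
begin

text \<open>
  If a frame field vanishes, its coefficient is normalised to zero; this makes coordinates unique.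
\<close>

definition coords :: "('a \<Rightarrow> 'a) \<Rightarrow> 'a \<Rightarrow> 'a \<Rightarrow> 'a \<Rightarrow> bool" where
  "coords D a1 a2 a3 \<longleftrightarrow> D = (\<lambda>p. a1 * D1 p + a2 * D2 p + a3 * D3 p) \<and>
     (D1 = (\<lambda>_. 0) \<longrightarrow> a1 = 0) \<and> (D2 = (\<lambda>_. 0) \<longrightarrow> a2 = 0) \<and> (D3 = (\<lambda>_. 0) \<longrightarrow> a3 = 0)"

lemma coords_unique:
  assumes "coords D a1 a2 a3" "coords D b1 b2 b3"
  shows "a1 = b1 \<and> a2 = b2 \<and> a3 = b3"
proof -
  have "(a1 - b1) * D1 p + (a2 - b2) * D2 p + (a3 - b3) * D3 p = 0" for p
  proof -
    have "a1 * D1 p + a2 * D2 p + a3 * D3 p = b1 * D1 p + b2 * D2 p + b3 * D3 p"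
      using assms unfolding coords_def by metis
    then show ?thesis by (simp add: algebra_simps)
  qed
  moreover have "D1 = (\<lambda>_. 0) \<Longrightarrow> a1 - b1 = 0" "D2 = (\<lambda>_. 0) \<Longrightarrow> a2 - b2 = 0"
    "D3 = (\<lambda>_. 0) \<Longrightarrow> a3 - b3 = 0"
    using assms unfolding coords_def by simp_all
  ultimately have "a1 - b1 = 0 \<and> a2 - b2 = 0 \<and> a3 - b3 = 0" by (rule indep)
  then show ?thesis by simp
qed

lemma ex_coords:
  assumes "D \<in> G"
  obtains a1 a2 a3 where "coords D a1 a2 a3" "a1 \<in> level m" "a2 \<in> level m" "D2 a2 = 0" "a3 \<in> const"
  using G_coords[OF assms] unfolding coords_def by blast

lemma coords_level:
  assumes "D \<in> G" "coords D a1 a2 a3"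
  shows "a1 \<in> level m" "a2 \<in> level m" "D2 a2 = 0" "a3 \<in> const" "a1 \<in> nil_elems" "a2 \<in> nil_elems"
proof -
  obtain b1 b2 b3 where b: "coords D b1 b2 b3" "b1 \<in> level m" "b2 \<in> level m" "D2 b2 = 0" "b3 \<in> const"
    using ex_coords[OF assms(1)] by blast
  with coords_unique[OF assms(2) b(1)]
  show "a1 \<in> level m" "a2 \<in> level m" "D2 a2 = 0" "a3 \<in> const" "a1 \<in> nil_elems" "a2 \<in> nil_elems"
    using nil_elemsI by auto
qed

lemma coords_add:
  assumes "coords D a1 a2 a3" "coords E b1 b2 b3"
  shows "coords (\<lambda>p. D p + E p) (a1 + b1) (a2 + b2) (a3 + b3)"
  using assms by (auto simp: coords_def algebra_simps)

lemma coords_scale: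
  assumes "coords D a1 a2 a3"
  shows "coords (\<lambda>p. r * D p) (r * a1) (r * a2) (r * a3)"
  using assms by (auto simp: coords_def algebra_simps)

text \<open>All derivatives of the third coordinates and all \<open>D1\<close>-derivatives vanish,
  as do the \<open>D2\<close>-derivatives of the second coordinates. The term in \<open>c\<close> is
  the contribution of [D3, D2].\<close>

lemma coords_bracket:
  assumes G: "D \<in> G" "E \<in> G" and D: "coords D a1 a2 a3" and E: "coords E b1 b2 b3"
  shows "coords (lie_bracket D E)
    (a2 * D2 b1 + a3 * D3 b1 - (b2 * D2 a1 + b3 * D3 a1) + (a3 * b2 - a2 * b3) * c)
    (a3 * D3 b2 - b3 * D3 a2) 0"
proof -
  note a = coords_level[OF G(1) D] and b = coords_level[OF G(2) E]
  have z: "D1 a1 = 0" "D1 a2 = 0" "D1 a3 = 0" "D2 a2 = 0" "D2 a3 = 0" "D3 a3 = 0"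
    "D1 b1 = 0" "D1 b2 = 0" "D1 b3 = 0" "D2 b2 = 0" "D2 b3 = 0" "D3 b3 = 0"
    using a b level_D(1) by (auto simp: const_def)
  have "D = (\<lambda>p. a1 * D1 p + a2 * D2 p + a3 * D3 p)" "E = (\<lambda>p. b1 * D1 p + b2 * D2 p + b3 * D3 p)"
    using D E by (auto simp: coords_def)
  then have "lie_bracket D E = (\<lambda>p.
    (a2 * D2 b1 + a3 * D3 b1 - (b2 * D2 a1 + b3 * D3 a1) + (a3 * b2 - a2 * b3) * c) * D1 p +
    (a3 * D3 b2 - b3 * D3 a2) * D2 p + 0 * D3 p)"
    unfolding lie_bracket_def
    by (intro ext) (simp add: der_simps z comm algebra_simps)
  moreover have "D1 = (\<lambda>_. 0) \<Longrightarrow> a1 = 0 \<and> b1 = 0 \<and> c = 0" "D2 = (\<lambda>_. 0) \<Longrightarrow> a2 = 0 \<and> b2 = 0"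
    using D E c(2) unfolding coords_def by simp_all
  ultimately show ?thesis unfolding coords_def by (auto simp: der_simps)
qed

text \<open>This makes the coefficient of d/dx2 a polynomial in x3 alone, as \<open>u3\<close>
  demands.\<close>

lemma taylor_ker_D2:
  assumes "f \<in> nil_elems" "D2 f = 0"
  shows "taylor f = [:coeff (taylor f) 0:]"
proof -
  have "pderiv (taylor f) = 0" using pderiv_taylor[OF assms(1)] assms(2) taylor_zero by simp
  then have "degree (taylor f) = 0" by (simp add: pderiv_eq_0_iff)
  then show ?thesis by (metis degree_eq_zeroE coeff_pCons_0)
qed

lemma const_taylor_mult: "r \<in> const \<Longrightarrow> f \<in> nil_elems \<Longrightarrow> taylor (r * f) = [:[:r:]:] * taylor f"
  using taylor_mult[of r f] taylor_const[of r] const_nil by auto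

text \<open>
  \<open>D\<^sub>1, D\<^sub>2, D\<^sub>3\<close> are sent to \<open>\<partial>\<^sub>1, \<partial>\<^sub>2, h \<partial>\<^sub>1 + \<partial>\<^sub>3\<close>, where \<open>h\<close> is chosen such that the bracket
  \<open>[D\<^sub>3, D\<^sub>2] = c D\<^sub>1\<close> is preserved; coefficients are replaced by their Taylor expansions.
\<close>

theorem isomorphic_triangular:
  "\<exists>M. lie_subalgebra (const3 ` const) M (u3 const) \<and> fin_dim_over (const3 ` const) M \<and>
     lie_isomorphic_over const const3 G M"
proof -
  note F = const_subring const_inverse
  have "- taylor c \<in> polys_over (polys_over const)"
    using taylor_polys_over[OF c(1)] subring_setD(4)[OF subring_polys_over[OF subring_polys_over[OF const_subring]]]
    by blast
  then obtain h where h: "h \<in> polys_over (polys_over const)" "pderiv h = - taylor c"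
    using ex_antiderivative[OF F] by blast
  \<comment> \<open>The summand with \<open>h\<close> is the d/dx1 part of the image of
    \<open>D3\<close>. Taking \<open>coeff _ 0\<close> only strips the outer variable, of which
    \<open>taylor a2\<close> is independent.\<close>
  define \<psi> where "\<psi> a1 a2 a3 =
    triangular_field const (taylor a1 + [:[:a3:]:] * h) (coeff (taylor a2) 0) a3" for a1 a2 a3
  define \<phi> where "\<phi> D = (THE X. \<exists>a1 a2 a3. coords D a1 a2 a3 \<and> X = \<psi> a1 a2 a3)" for D
  have \<phi>: "\<phi> D = \<psi> a1 a2 a3" if "coords D a1 a2 a3" for D a1 a2 a3
    unfolding \<phi>_def
  proof (rule the_equality)
    show "X = \<psi> a1 a2 a3" if "\<exists>a1 a2 a3. coords D a1 a2 a3 \<and> X = \<psi> a1 a2 a3" for X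
      using that coords_unique[OF \<open>coords D a1 a2 a3\<close>] by blast
  qed (use that in blast)
  note P1 = subring_polys_over[OF const_subring] and P2 = subring_polys_over[OF subring_polys_over[OF const_subring]]
  have const2: "[:[:r:]:] \<in> polys_over (polys_over const)" if "r \<in> const" for r
    using that by (intro pCons_polys_over P1 const_subring)
  have mem: "taylor a1 + [:[:a3:]:] * h \<in> polys_over (polys_over const)"
    "coeff (taylor a2) 0 \<in> polys_over const" "a3 \<in> const"
    if "D \<in> G" "coords D a1 a2 a3" for D a1 a2 a3
  proof -
    note l = coords_level[OF that]
    show "a3 \<in> const" by (rule l)
    show "taylor a1 + [:[:a3:]:] * h \<in> polys_over (polys_over const)"
      by (intro subring_setD(3,5)[OF P2] const2 taylor_polys_over l h)
    show "coeff (taylor a2) 0 \<in> polys_over const"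
      using taylor_polys_over[OF l(6)] by (simp add: polys_over_def[of "polys_over const"])
  qed
  have add: "\<phi> (\<lambda>p. D p + E p) = (\<lambda>q. \<phi> D q + \<phi> E q)" if G: "D \<in> G" "E \<in> G" for D E
  proof -
    obtain a1 a2 a3 b1 b2 b3 where a: "coords D a1 a2 a3" and b: "coords E b1 b2 b3"
      using ex_coords[OF G(1)] ex_coords[OF G(2)] by metis
    note l = coords_level[OF G(1) a] coords_level[OF G(2) b]
    have "[:[:a3 + b3:]:] = [:[:a3:]:] + [:[:b3:]:]" by simp
    then have "taylor (a1 + b1) + [:[:a3 + b3:]:] * h = taylor a1 + [:[:a3:]:] * h + (taylor b1 + [:[:b3:]:] * h)"
      by (simp only: taylor_add l algebra_simps)
    then show ?thesis
      unfolding \<phi>[OF a] \<phi>[OF b] \<phi>[OF coords_add[OF a b]] \<psi>_def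
        triangular_field_add[OF const_subring] by (simp only: taylor_add l coeff_add)
  qed
  have scale: "\<phi> (\<lambda>p. r * D p) = (\<lambda>q. const3 r * \<phi> D q)" if r: "r \<in> const" and G: "D \<in> G" for r D
  proof -
    obtain a1 a2 a3 where a: "coords D a1 a2 a3" using ex_coords[OF G] by metis
    note l = coords_level[OF G a]
    have "[:[:r * a3:]:] = [:[:r:]:] * [:[:a3:]:]" by simp
    then have "taylor (r * a1) + [:[:r * a3:]:] * h = [:[:r:]:] * (taylor a1 + [:[:a3:]:] * h)"
      by (simp only: const_taylor_mult[OF r l(5)] distrib_left mult.assoc)
    moreover have "coeff (taylor (r * a2)) 0 = [:r:] * coeff (taylor a2) 0"
      by (simp add: const_taylor_mult l r)
    ultimately show ?thesis
      unfolding \<phi>[OF a] \<phi>[OF coords_scale[OF a]] \<psi>_def triangular_field_scale[OF const_subring]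
      by simp
  qed
  have bracket: "\<phi> (lie_bracket D E) = lie_bracket (\<phi> D) (\<phi> E)" if G: "D \<in> G" "E \<in> G" for D E
  proof -
    obtain a1 a2 a3 b1 b2 b3 where a: "coords D a1 a2 a3" and b: "coords E b1 b2 b3"
      using ex_coords[OF G(1)] ex_coords[OF G(2)] by metis
    note l = coords_level[OF G(1) a] coords_level[OF G(2) b]
    have n: "a3 \<in> nil_elems" "b3 \<in> nil_elems" using l const_nil by auto
    note md = derivation_simps(1,2)[OF map_poly_derivation[OF pderiv_derivation]]
    define g g' where "g = coeff (taylor a2) 0" and "g' = coeff (taylor b2) 0"
    have g: "[:g:] = taylor a2" "[:g':] = taylor b2"
      using taylor_ker_D2 l unfolding g_def g'_def by metis+
    define f f' where "f = taylor a1 + [:[:a3:]:] * h" and "f' = taylor b1 + [:[:b3:]:] * h"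
    have pd: "pderiv [:[:r:]:] = 0" "map_poly pderiv [:[:r:]:] = 0" for r :: 'a
      by (simp_all add: map_poly_pCons)
    have f: "pderiv f = taylor (D2 a1) - [:[:a3:]:] * taylor c"
      "pderiv f' = taylor (D2 b1) - [:[:b3:]:] * taylor c"
      "map_poly pderiv f = taylor (D3 a1) + [:[:a3:]:] * map_poly pderiv h"
      "map_poly pderiv f' = taylor (D3 b1) + [:[:b3:]:] * map_poly pderiv h"
      unfolding f_def f'_def pderiv_add pderiv_mult md pd h(2)
      by (simp_all add: pderiv_taylor map_pderiv_taylor l)
    note cl = nil_elems_add nil_elems_mult nil_elems_D subring_setD(6)[OF nil_elems_subring] l n c(1)
    have "taylor (a2 * D2 b1 + a3 * D3 b1 - (b2 * D2 a1 + b3 * D3 a1) + (a3 * b2 - a2 * b3) * c) =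
      taylor a2 * taylor (D2 b1) + [:[:a3:]:] * taylor (D3 b1) -
        (taylor b2 * taylor (D2 a1) + [:[:b3:]:] * taylor (D3 a1)) +
        ([:[:a3:]:] * taylor b2 - taylor a2 * [:[:b3:]:]) * taylor c"
      by (simp only: cl taylor_add taylor_diff taylor_mult taylor_const)
    \<comment> \<open>The two terms with the x3-derivative of \<open>h\<close> cancel; the summands
      \<open>- taylor c\<close> in the x2-derivatives account for the term in
      \<open>c\<close>.\<close>
    also have "\<dots> = [:g:] * pderiv f' + [:[:a3:]:] * map_poly pderiv f' -
        ([:g':] * pderiv f + [:[:b3:]:] * map_poly pderiv f)"
      unfolding f g by (simp only: algebra_simps)
    finally have 1: "taylor (a2 * D2 b1 + a3 * D3 b1 - (b2 * D2 a1 + b3 * D3 a1) + (a3 * b2 - a2 * b3) * c) +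
      [:[:0:]:] * h = \<dots>" by simp
    have D3t: "[:pderiv g:] = taylor (D3 a2)" "[:pderiv g':] = taylor (D3 b2)"
      using map_pderiv_taylor[OF l(6)] map_pderiv_taylor[OF l(12)] unfolding g[symmetric]
      by (simp_all add: map_poly_pCons)
    have "taylor (a3 * D3 b2 - b3 * D3 a2) = [:[:a3:]:] * taylor (D3 b2) - [:[:b3:]:] * taylor (D3 a2)"
      by (simp only: cl taylor_add taylor_diff taylor_mult taylor_const)
    then have 2: "coeff (taylor (a3 * D3 b2 - b3 * D3 a2)) 0 = [:a3:] * pderiv g' - [:b3:] * pderiv g"
      by (simp add: D3t[symmetric])
    show ?thesis
      unfolding \<phi>[OF a] \<phi>[OF b] \<phi>[OF coords_bracket[OF G a b]] \<psi>_def 1 2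
      unfolding f_def[symmetric] f'_def[symmetric] g_def[symmetric] g'_def[symmetric]
      by (rule triangular_field_bracket[symmetric, OF const_subring])
        (use mem[OF G(1) a] mem[OF G(2) b] in \<open>simp_all add: f_def f'_def g_def g'_def\<close>)
  qed
  have inj: "inj_on \<phi> G"
  proof (rule inj_onI)
    fix D E assume G: "D \<in> G" "E \<in> G" and e: "\<phi> D = \<phi> E"
    obtain a1 a2 a3 b1 b2 b3 where a: "coords D a1 a2 a3" and b: "coords E b1 b2 b3"
      using ex_coords[OF G(1)] ex_coords[OF G(2)] by metis
    note l = coords_level[OF G(1) a] coords_level[OF G(2) b]
    have e: "taylor a1 = taylor b1" "coeff (taylor a2) 0 = coeff (taylor b2) 0" "a3 = b3"
      using e unfolding \<phi>[OF a] \<phi>[OF b] \<psi>_def triangular_field_inject[OF const_subring] by auto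
    then have "taylor a2 = taylor b2" using taylor_ker_D2 l by metis
    then have "taylor (a1 - b1) = 0" "taylor (a2 - b2) = 0" using e l by (simp_all add: taylor_diff)
    moreover have "a1 - b1 \<in> nil_elems" "a2 - b2 \<in> nil_elems"
      using subring_setD(6)[OF nil_elems_subring] l by auto
    ultimately have "a1 - b1 = 0" "a2 - b2 = 0" using taylor_eq_zeroD by blast+
    then show "D = E" using a b e by (simp add: coords_def)
  qed
  have zero: "\<phi> (\<lambda>_. 0) = (\<lambda>_. 0)"
    using scale[OF subring_setD(1)[OF const_subring] G_zero] by (simp add: const3_def)
  define M where "M = \<phi> ` G"
  have "lie_subalgebra (const3 ` const) M (u3 const)"
    unfolding lie_subalgebra_def
  proof (intro conjI ballI)
    show "M \<subseteq> u3 const"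
    proof
      fix X assume "X \<in> M"
      then obtain D where D: "D \<in> G" "X = \<phi> D" by (auto simp: M_def)
      then obtain a1 a2 a3 where "coords D a1 a2 a3" using ex_coords by metis
      then show "X \<in> u3 const"
        unfolding D(2) using mem[OF D(1)] by (simp add: \<phi> \<psi>_def triangular_field_u3[OF const_subring])
    qed
    show "(\<lambda>_. 0) \<in> M" unfolding M_def using zero G_zero by (metis imageI)
  next
    fix X Y assume "X \<in> M" "Y \<in> M"
    then obtain D E where G: "D \<in> G" "E \<in> G" "X = \<phi> D" "Y = \<phi> E" by (auto simp: M_def)
    show "(\<lambda>p. X p + Y p) \<in> M" "lie_bracket X Y \<in> M"
      unfolding G(3,4) add[OF G(1,2), symmetric] bracket[OF G(1,2), symmetric] M_def
      using G_add[OF G(1,2)] G_bracket[OF G(1,2)] by blast+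
  next
    fix x X assume "x \<in> const3 ` const" "X \<in> M"
    then obtain r D where G: "x = const3 r" "r \<in> const" "D \<in> G" "X = \<phi> D" by (auto simp: M_def)
    show "(\<lambda>p. x * X p) \<in> M"
      unfolding G(1,4) scale[OF G(2,3), symmetric] M_def using G_scale[OF G(2,3)] by blast
  qed
  moreover have "fin_dim_over (const3 ` const) M"
  proof -
    obtain k where k: "\<And>i j. i \<ge> k \<or> j \<ge> k \<Longrightarrow> coeff (coeff h i) j = 0" using poly2_bounded by metis
    show ?thesis
    \<comment> \<open>\<open>m\<close> bounds the exponents in the expansions of the coordinates,
      \<open>k\<close> those in the fixed polynomial \<open>h\<close>.\<close>
    proof (rule fin_dim_triangular_fields[where n = "max m k", OF F])
      fix X assume "X \<in> M"
      then obtain D where D: "D \<in> G" "X = \<phi> D" by (auto simp: M_def)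
      then obtain a1 a2 a3 where a: "coords D a1 a2 a3" using ex_coords by metis
      note l = coords_level[OF D(1) a]
      have "coeff (coeff (taylor a1 + [:[:a3:]:] * h) i) j = 0" if "i \<ge> max m k \<or> j \<ge> max m k" for i j
        using taylor_level[OF l(1), of i j] k[of i j] that by auto
      moreover have "coeff (coeff (taylor a2) 0) j = 0" if "j \<ge> max m k" for j
        using taylor_level[OF l(2), of 0 j] that by simp
      ultimately show "\<exists>f g c. X = triangular_field const f g c \<and>
        f \<in> polys_over (polys_over const) \<and> g \<in> polys_over const \<and> c \<in> const \<and>
        (\<forall>i j. i \<ge> max m k \<or> j \<ge> max m k \<longrightarrow> coeff (coeff f i) j = 0) \<and>
        (\<forall>j\<ge>max m k. coeff g j = 0)"
        unfolding D(2) \<phi>[OF a] \<psi>_def using mem[OF D(1) a] by blast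
    qed (use \<open>lie_subalgebra (const3 ` const) M (u3 const)\<close> in \<open>auto simp: lie_subalgebra_def\<close>)
  qed
  moreover have "lie_isomorphic_over const const3 G M"
    unfolding lie_isomorphic_over_def
    using inj add scale bracket by (intro exI[of _ \<phi>]) (auto simp: bij_betw_def M_def)
  ultimately show ?thesis by blast
qed

end

section \<open>Frames adapted to a nilpotent Lie algebra of derivations\<close>

text \<open>Gaussian elimination: the pivot row \<open>k\<close> clears column \<open>j\<close> in
  the other rows, and the coefficient of row \<open>k\<close> is recovered from a relation among
  those.\<close>

lemma ex_nontrivial_relation:
  fixes a :: "'i \<Rightarrow> 'j \<Rightarrow> 'a::field"
  assumes "finite J" "finite I" "card J < card I"
  shows "\<exists>r. (\<exists>i\<in>I. r i \<noteq> 0) \<and> (\<forall>j\<in>J. (\<Sum>i\<in>I. r i * a i j) = 0)"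
  using assms
proof (induction J arbitrary: I a rule: finite_induct)
  case empty
  then have "I \<noteq> {}" by auto
  then show ?case by (intro exI[of _ "\<lambda>_. 1"]) auto
next
  case (insert j J)
  show ?case
  proof (cases "\<forall>i\<in>I. a i j = 0")
    case True
    moreover have "card J < card I" using insert by simp
    ultimately show ?thesis using insert.IH[of I a] insert.prems by auto
  next
    case False
    then obtain k where k: "k \<in> I" "a k j \<noteq> 0" by blast
    let ?I = "I - {k}"
    define a' where "a' i l = a i l - a i j / a k j * a k l" for i l
    have "card J < card ?I" using insert k by simp
    then obtain r where r: "\<exists>i\<in>?I. r i \<noteq> 0" "\<And>l. l \<in> J \<Longrightarrow> (\<Sum>i\<in>?I. r i * a' i l) = 0"
      using insert.IH[of ?I a'] insert.prems by auto
    define r' where "r' = r(k := - (\<Sum>i\<in>?I. r i * a i j / a k j))"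
    have s: "(\<Sum>i\<in>I. r' i * a i l) = (\<Sum>i\<in>?I. r i * a' i l)" for l
    proof -
      have "(\<Sum>i\<in>I. r' i * a i l) = r' k * a k l + (\<Sum>i\<in>?I. r' i * a i l)"
        using k insert.prems by (simp add: sum.remove)
      also have "(\<Sum>i\<in>?I. r' i * a i l) = (\<Sum>i\<in>?I. r i * a i l)"
        by (rule sum.cong) (auto simp: r'_def)
      also have "r' k * a k l = - (\<Sum>i\<in>?I. r i * a i j / a k j * a k l)"
        by (simp add: r'_def sum_distrib_right)
      finally show ?thesis by (simp add: a'_def algebra_simps sum_subtractf)
    qed
    have "(\<Sum>i\<in>?I. r i * a' i j) = 0" using k by (simp add: a'_def)
    then have "\<forall>l\<in>insert j J. (\<Sum>i\<in>I. r' i * a i l) = 0" using r(2) by (simp add: s)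
    moreover have "\<exists>i\<in>I. r' i \<noteq> 0" using r(1) by (auto simp: r'_def)
    ultimately show ?thesis by blast
  qed
qed

text \<open>The chain \<open>C\<close> has just the properties of a lower central series, so that
  the images under \<open>der_ext\<close> of the series of a polynomial Lie algebra can be taken for
  it.\<close>

locale nilpotent_derivations =
  fixes L :: "('a::field_char_0 \<Rightarrow> 'a) set" and C :: "nat \<Rightarrow> ('a \<Rightarrow> 'a) set" and N :: nat
    and K :: "'a set"
  assumes der: "D \<in> L \<Longrightarrow> D \<in> derivations K UNIV"
    and one: "1 \<in> K"
    and zero: "(\<lambda>_. 0) \<in> L"
    and C: "C 0 = L" "C n \<subseteq> L" "D \<in> L \<Longrightarrow> E \<in> C n \<Longrightarrow> lie_bracket D E \<in> C (Suc n)" "C N \<subseteq> {\<lambda>_. 0}"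
    and rank_le_3: "\<exists>E :: nat \<Rightarrow> 'a \<Rightarrow> 'a. \<forall>D\<in>L. \<exists>a. D = (\<lambda>p. \<Sum>i<3. a i * E i p)"
begin

definition constants :: "'a set" where
  "constants = {r. \<forall>D\<in>L. D r = 0}"

definition alg :: "('a \<Rightarrow> 'a) set" where
  "alg = lin_span K {(\<lambda>p. a * D p) | a D. a \<in> constants \<and> D \<in> L}"

lemma L_bracket: "D \<in> L \<Longrightarrow> E \<in> L \<Longrightarrow> lie_bracket D E \<in> L"
  using C(1) C(2)[of "Suc 0"] C(3)[of D E 0] by auto

lemma K_constants: "K \<subseteq> constants"
  using der derivation_scalar unfolding constants_def by blast

lemma constants_mult: "a \<in> constants \<Longrightarrow> b \<in> constants \<Longrightarrow> a * b \<in> constants"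
  unfolding constants_def using derivation_simps(2)[OF der] by force

lemma alg_step:
  assumes "a \<in> constants" "D \<in> L" "E \<in> alg"
  shows "(\<lambda>p. a * D p + E p) \<in> alg"
proof -
  have "(\<lambda>p. a * D p) \<in> {(\<lambda>p. a * D p) | a D. a \<in> constants \<and> D \<in> L}"
    using assms by blast
  from step_in_lin_span[OF one this assms(3)[unfolded alg_def]] show ?thesis
    by (simp add: alg_def)
qed

text \<open>The scalars in \<open>K\<close> are themselves constants and are absorbed into the
  coefficient.\<close>

lemma alg_induct [consumes 1, case_names zero step]:
  assumes "E \<in> alg" and z: "P (\<lambda>_. 0)"
    and s: "\<And>a D E. a \<in> constants \<Longrightarrow> D \<in> L \<Longrightarrow> E \<in> alg \<Longrightarrow> P E \<Longrightarrow> P (\<lambda>p. a * D p + E p)"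
  shows "P E"
  using assms(1) unfolding alg_def
proof (induction rule: lin_span_induct)
  case (step r X E)
  then obtain a D where X: "X = (\<lambda>p. a * D p)" "a \<in> constants" "D \<in> L" by blast
  have "P (\<lambda>p. (r * a) * D p + E p)"
    using s[of "r * a" D E] step X K_constants constants_mult by (auto simp: alg_def)
  then show ?case by (simp add: X mult.assoc)
qed (rule z)

lemma zero_alg: "(\<lambda>_. 0) \<in> alg"
  unfolding alg_def by (rule zero_in_lin_span)

lemma alg_add: "D \<in> alg \<Longrightarrow> E \<in> alg \<Longrightarrow> (\<lambda>p. D p + E p) \<in> alg"
  unfolding alg_def by (rule lin_span_add)

lemma alg_scale:
  assumes "r \<in> constants" "D \<in> alg"
  shows "(\<lambda>p. r * D p) \<in> alg"
  using assms(2)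
proof (induction rule: alg_induct)
  case (step a D E)
  have "(\<lambda>p. (r * a) * D p + r * E p) \<in> alg"
    by (rule alg_step) (use step assms constants_mult in auto)
  then show ?case by (simp add: algebra_simps)
qed (simp add: zero_alg)

lemma alg_derivation:
  assumes "D \<in> alg"
  shows "D \<in> derivations {} UNIV \<and> (\<forall>r\<in>constants. D r = 0)"
  using assms
proof (induction rule: alg_induct)
  case zero
  then show ?case by (simp add: derivations_def)
next
  case (step a D E)
  note d = derivation_simps[OF der[OF step(2)]]
  have E: "E \<in> derivations {} UNIV" and z: "\<And>r. r \<in> constants \<Longrightarrow> E r = 0" using step by auto
  have "(\<lambda>p. a * D p + E p) \<in> derivations {} UNIV"
    unfolding derivations_def by (auto simp: d derivation_simps[OF E] algebra_simps)
  moreover have "a * D r + E r = 0" if "r \<in> constants" for r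
    using that step(2) z by (simp add: constants_def)
  ultimately show ?case by blast
qed

text \<open>All elements of \<open>alg\<close> kill the constants, so the bracket is bilinear over
  them and the claim reduces to \<open>L\<close>.\<close>

lemma alg_bracket:
  assumes "D \<in> alg" "E \<in> alg"
  shows "lie_bracket D E \<in> alg"
  using assms(1)
proof (induction rule: alg_induct)
  case zero
  have "E 0 = 0" using alg_derivation[OF assms(2)] derivation_simps(3) by blast
  then show ?case by (simp add: lie_bracket_def zero_alg)
next
  case (step a D D')
  have E: "E \<in> derivations {} UNIV" "E a = 0" using alg_derivation[OF assms(2)] step(1) by auto
  note d = derivation_simps[OF der[OF step(2)]]
  have "lie_bracket D E \<in> alg"
    using assms(2)
  proof (induction rule: alg_induct)
    case zero
    show ?case by (simp add: lie_bracket_def zero_alg d)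
  next
    case (step b E' E'')
    have "D b = 0" using step(1) \<open>D \<in> L\<close> by (simp add: constants_def)
    then have "lie_bracket D (\<lambda>p. b * E' p + E'' p) = (\<lambda>p. b * lie_bracket D E' p + lie_bracket D E'' p)"
      by (auto simp: lie_bracket_def d algebra_simps)
    then show ?case using alg_step[OF step(1) L_bracket[OF \<open>D \<in> L\<close> step(2)] step(4)] by simp
  qed
  then have "(\<lambda>p. a * lie_bracket D E p + lie_bracket D' E p) \<in> alg"
    using alg_add[OF alg_scale[OF step(1)] step(4)] by blast
  moreover have "lie_bracket (\<lambda>p. a * D p + D' p) E = (\<lambda>p. a * lie_bracket D E p + lie_bracket D' E p)"
    by (auto simp: lie_bracket_def derivation_simps[OF E(1)] E(2) algebra_simps)
  ultimately show ?case by simp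
qed

text \<open>
  \<open>D\<close> is taken in the last term of the series not contained in \<open>V\<close>; if there is none, then \<open>D = 0\<close>.
\<close>

lemma ex_central_mod:
  assumes V: "(\<lambda>_. 0) \<in> V"
  obtains D where "D \<in> L" "D \<in> V \<Longrightarrow> D = (\<lambda>_. 0)" "D = (\<lambda>_. 0) \<Longrightarrow> L \<subseteq> V"
    "\<And>E. E \<in> L \<Longrightarrow> lie_bracket E D \<in> V"
proof (cases "L \<subseteq> V")
  case True
  have "lie_bracket E (\<lambda>_. 0) = (\<lambda>_. 0)" if "E \<in> L" for E
    using derivation_simps(3)[OF der[OF that]] by (simp add: lie_bracket_def)
  then show thesis using that[of "\<lambda>_. 0"] zero True V by simp
next
  case False
  define n where "n = (LEAST n. C n \<subseteq> V)"
  have "C N \<subseteq> V" using C(4) V by blast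
  then have n: "C n \<subseteq> V" unfolding n_def by (rule LeastI)
  then obtain k where k: "n = Suc k" using False C(1) by (cases n) auto
  then have "\<not> C k \<subseteq> V" unfolding n_def using not_less_Least[of k "\<lambda>n. C n \<subseteq> V"] by simp
  then obtain D where D: "D \<in> C k" "D \<notin> V" by blast
  show thesis
  proof (rule that[of D])
    show "D \<in> L" using D C(2) by blast
    show "lie_bracket E D \<in> V" if "E \<in> L" for E using C(3)[OF that D(1)] n k by blast
  qed (use D V in auto)
qed

lemma isomorphic_triangular:
  "\<exists>M. lie_subalgebra (const3 ` constants) M (u3 constants) \<and> fin_dim_over (const3 ` constants) M \<and>
     lie_isomorphic_over constants const3 alg M"
proof -
  obtain D1 where D1: "D1 \<in> L" "\<And>E. E \<in> L \<Longrightarrow> lie_bracket E D1 \<in> {\<lambda>_. 0}"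
    and sp1: "D1 = (\<lambda>_. 0) \<Longrightarrow> L \<subseteq> {\<lambda>_. 0}"
    by (rule ex_central_mod[of "{\<lambda>_. 0}"]) auto
  \<comment> \<open>\<open>V2\<close> and \<open>V3\<close> are spans over the whole field, not only
    over the constants.\<close>
  define V2 where "V2 = {(\<lambda>p. a * D1 p) | a. True}"
  have V20: "(\<lambda>_. 0) \<in> V2" unfolding V2_def by (auto intro!: exI[of _ 0])
  obtain D2 where D2: "D2 \<in> L" "D2 \<in> V2 \<Longrightarrow> D2 = (\<lambda>_. 0)" "\<And>E. E \<in> L \<Longrightarrow> lie_bracket E D2 \<in> V2"
    and sp2: "D2 = (\<lambda>_. 0) \<Longrightarrow> L \<subseteq> V2"
    by (rule ex_central_mod[OF V20]) auto
  define V3 where "V3 = {(\<lambda>p. a * D1 p + b * D2 p) | a b. True}"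
  have V30: "(\<lambda>_. 0) \<in> V3" unfolding V3_def by (auto intro!: exI[of _ 0])
  obtain D3 where D3: "D3 \<in> L" "D3 \<in> V3 \<Longrightarrow> D3 = (\<lambda>_. 0)" "D3 = (\<lambda>_. 0) \<Longrightarrow> L \<subseteq> V3"
    "\<And>E. E \<in> L \<Longrightarrow> lie_bracket E D3 \<in> V3"
    by (rule ex_central_mod[OF V30]) auto
  have indep: "a1 = 0 \<and> a2 = 0 \<and> a3 = 0"
    if rel: "\<And>p. a1 * D1 p + a2 * D2 p + a3 * D3 p = 0"
      and norm: "D1 = (\<lambda>_. 0) \<Longrightarrow> a1 = 0" "D2 = (\<lambda>_. 0) \<Longrightarrow> a2 = 0" "D3 = (\<lambda>_. 0) \<Longrightarrow> a3 = 0"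
    for a1 a2 a3
  proof -
    \<comment> \<open>A nonzero \<open>a3\<close> would put \<open>D3\<close> into
      \<open>V3\<close>, which by its choice forces \<open>D3\<close> to be zero, and then
      \<open>norm\<close> gives \<open>a3 = 0\<close> after all. Next, \<open>V2\<close> settles
      \<open>a2\<close> in the same way.\<close>
    have 3: "a3 = 0"
    proof (rule ccontr)
      assume a: "a3 \<noteq> 0"
      have "a3 * D3 p = a3 * ((- a1 / a3) * D1 p + (- a2 / a3) * D2 p)" for p
        using rel[of p] a by (simp add: distrib_left eq_neg_iff_add_eq_0 algebra_simps)
      then have "D3 = (\<lambda>p. (- a1 / a3) * D1 p + (- a2 / a3) * D2 p)" using a by auto
      then have "D3 \<in> V3" unfolding V3_def by blast
      then show False using D3(2) norm a by blast
    qed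
    have 2: "a2 = 0"
    proof (rule ccontr)
      assume a: "a2 \<noteq> 0"
      have e: "a2 * D2 p = a2 * ((- a1 / a2) * D1 p)" for p
        using rel[of p] a 3 by (simp add: eq_neg_iff_add_eq_0 algebra_simps)
      have "D2 = (\<lambda>p. (- a1 / a2) * D1 p)"
        by (rule ext) (rule mult_left_cancel[OF a, THEN iffD1, OF e])
      then have "D2 \<in> V2" unfolding V2_def by blast
      then show False using D2(2) norm a by blast
    qed
    have "a1 = 0" using rel norm(1) 2 3 by auto
    then show ?thesis using 2 3 by blast
  qed
  define coords where "coords D a1 a2 a3 \<longleftrightarrow> D = (\<lambda>p. a1 * D1 p + a2 * D2 p + a3 * D3 p) \<and>
     (D1 = (\<lambda>_. 0) \<longrightarrow> a1 = 0) \<and> (D2 = (\<lambda>_. 0) \<longrightarrow> a2 = 0) \<and> (D3 = (\<lambda>_. 0) \<longrightarrow> a3 = 0)"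
    for D a1 a2 a3
  have coordsI: "\<exists>a1 a2 a3. coords D a1 a2 a3" if "D = (\<lambda>p. a1 * D1 p + a2 * D2 p + a3 * D3 p)" for D a1 a2 a3
    unfolding coords_def that
    by (rule exI[of _ "if D1 = (\<lambda>_. 0) then 0 else a1"], rule exI[of _ "if D2 = (\<lambda>_. 0) then 0 else a2"],
        rule exI[of _ "if D3 = (\<lambda>_. 0) then 0 else a3"]) auto
  have span: "\<exists>a1 a2 a3. coords D a1 a2 a3" if D: "D \<in> L" for D
  proof (cases "L \<subseteq> V3")
    case True
    then obtain a b where "D = (\<lambda>p. a * D1 p + b * D2 p + 0 * D3 p)" using D unfolding V3_def by auto
    then show ?thesis by (rule coordsI)
  next
    case False
    have "(\<lambda>p. a * D1 p) = (\<lambda>p. a * D1 p + 0 * D2 p)" for a by simp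
    then have "V2 \<subseteq> V3" unfolding V2_def V3_def by blast
    then have nz: "D1 \<noteq> (\<lambda>_. 0)" "D2 \<noteq> (\<lambda>_. 0)" "D3 \<noteq> (\<lambda>_. 0)"
      using False sp1 sp2 D3(3) V30 by blast+
    obtain E :: "nat \<Rightarrow> 'a \<Rightarrow> 'a" where E: "\<And>D. D \<in> L \<Longrightarrow> \<exists>a. D = (\<lambda>p. \<Sum>i<3. a i * E i p)"
      using rank_le_3 by blast
    \<comment> \<open>Four elements in the span of three operators satisfy a nontrivial relation. As
      \<open>D1\<close>, \<open>D2\<close>, \<open>D3\<close> are nonzero and hence independent,
      \<open>D\<close> must occur in it.\<close>
    define X where "X i = (if i = 0 then D1 else if i = 1 then D2 else if i = 2 then D3 else D)" for i :: nat
    have "X i \<in> L" for i using D D1 D2 D3 by (simp add: X_def)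
    then have "\<exists>a. X i = (\<lambda>p. \<Sum>j<3. a j * E j p)" for i using E by blast
    then obtain a where a: "\<And>i. X i = (\<lambda>p. \<Sum>j<3. a i j * E j p)" by metis
    obtain r where r: "\<exists>i<4. r i \<noteq> 0" "\<And>j. j < 3 \<Longrightarrow> (\<Sum>i<(4::nat). r i * a i j) = 0"
      using ex_nontrivial_relation[of "{..<3::nat}" "{..<4::nat}" a] by auto
    have "(\<Sum>i<4. r i * X i p) = 0" for p
    proof -
      have "(\<Sum>i<4. r i * X i p) = (\<Sum>i<4. \<Sum>j<3. r i * a i j * E j p)"
        by (simp add: a sum_distrib_left mult.assoc)
      also have "\<dots> = (\<Sum>j<3. \<Sum>i<4. r i * a i j * E j p)" by (rule sum.swap)
      also have "\<dots> = (\<Sum>j<3. (\<Sum>i<4. r i * a i j) * E j p)" by (simp add: sum_distrib_right)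
      also have "\<dots> = 0" using r(2) by simp
      finally show ?thesis .
    qed
    then have rel: "r 0 * D1 p + r 1 * D2 p + r 2 * D3 p + r 3 * D p = 0" for p
      by (simp add: X_def eval_nat_numeral)
    have r3: "r 3 \<noteq> 0"
    proof
      assume z: "r 3 = 0"
      have "r 0 = 0 \<and> r 1 = 0 \<and> r 2 = 0"
        by (rule indep) (use rel z nz in auto)
      then show False using r(1) z by (auto simp: less_Suc_eq eval_nat_numeral)
    qed
    have "r 3 * D p = r 3 * ((- r 0 / r 3) * D1 p + (- r 1 / r 3) * D2 p + (- r 2 / r 3) * D3 p)" for p
      using rel[of p] r3 by (simp add: distrib_left eq_neg_iff_add_eq_0 algebra_simps)
    then have "D = (\<lambda>p. (- r 0 / r 3) * D1 p + (- r 1 / r 3) * D2 p + (- r 2 / r 3) * D3 p)"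
      using r3 by auto
    then show ?thesis by (rule coordsI)
  qed
  have derL: "D \<in> derivations {} UNIV" if "D \<in> L" for D
    using der[OF that] by (simp add: derivations_def)
  note d1 = derivation_simps[OF derL[OF D1(1)]] and d2 = derivation_simps[OF derL[OF D2(1)]]
    and d3 = derivation_simps[OF derL[OF D3(1)]]
  have D1_comm: "E (D1 p) = D1 (E p)" if "E \<in> L" for E p
    using fun_cong[OF singletonD[OF D1(2)[OF that]], of p] by (simp add: lie_bracket_def)
  have "\<exists>c. lie_bracket D3 D2 = (\<lambda>p. c * D1 p) \<and> (D1 = (\<lambda>_. 0) \<longrightarrow> c = 0)"
    using D2(3)[OF D3(1)] unfolding V2_def by (cases "D1 = (\<lambda>_. 0)") auto
  then obtain c where c: "lie_bracket D3 D2 = (\<lambda>p. c * D1 p)" "D1 = (\<lambda>_. 0) \<Longrightarrow> c = 0" by blast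
  have D3D2: "D3 (D2 p) = D2 (D3 p) + c * D1 p" for p
    using fun_cong[OF c(1), of p] by (simp add: lie_bracket_def algebra_simps)
  interpret derivation_frame D1 D2 D3 c
    by unfold_locales (use D1 D2 D3 derL D1_comm[OF D2(1)] D1_comm[OF D3(1)] D3D2 in auto)
  have const: "const = constants"
  proof
    show "constants \<subseteq> const" using D1(1) D2(1) D3(1) by (auto simp: constants_def const_def)
    show "const \<subseteq> constants"
    proof
      fix r assume r: "r \<in> const"
      have "D r = 0" if "D \<in> L" for D using span[OF that] r unfolding coords_def const_def by auto
      then show "r \<in> constants" by (simp add: constants_def)
    qed
  qed
  \<comment> \<open>Coefficients are compared in [D, D1] = 0, in [D, D2] as an element of
    \<open>V2\<close> and in [D, D3] as an element of \<open>V3\<close>; \<open>indep\<close> turns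
    each into equations for the coordinates.\<close>
  have coefs: "D1 a1 = 0" "D1 a2 = 0" "D2 a2 = 0" "a3 \<in> const"
    if D: "D \<in> L" and co: "coords D a1 a2 a3" for D a1 a2 a3
  proof -
    have Dp: "D p = a1 * D1 p + a2 * D2 p + a3 * D3 p" for p using co by (simp add: coords_def)
    have n: "D1 = (\<lambda>_. 0) \<Longrightarrow> a1 = 0" "D2 = (\<lambda>_. 0) \<Longrightarrow> a2 = 0" "D3 = (\<lambda>_. 0) \<Longrightarrow> a3 = 0"
      using co unfolding coords_def by simp_all
    have "D1 a1 * D1 p + D1 a2 * D2 p + D1 a3 * D3 p = 0" for p
      using D1_comm[OF D, of p] by (simp add: Dp der_simps comm algebra_simps)
    then have 1: "D1 a1 = 0 \<and> D1 a2 = 0 \<and> D1 a3 = 0"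
      by (rule indep) (use n in \<open>auto simp: der_simps\<close>)
    obtain e where e: "lie_bracket D D2 = (\<lambda>p. e * D1 p)" using D2(3)[OF D] by (auto simp: V2_def)
    \<comment> \<open>If \<open>D1\<close> vanishes, its coefficient is arbitrary, whereas
      \<open>indep\<close> asks for 0.\<close>
    define u where "u = (if D1 = (\<lambda>_. 0) then 0 else e - a3 * c + D2 a1)"
    have "u * D1 p + D2 a2 * D2 p + D2 a3 * D3 p = 0" for p
    proof -
      have "(e - a3 * c + D2 a1) * D1 p + D2 a2 * D2 p + D2 a3 * D3 p = 0"
        using fun_cong[OF e, of p] by (simp add: lie_bracket_def Dp der_simps comm algebra_simps)
      then show ?thesis by (cases "D1 = (\<lambda>_. 0)"; simp add: u_def)
    qed
    then have 2: "u = 0 \<and> D2 a2 = 0 \<and> D2 a3 = 0"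
      by (rule indep) (use n in \<open>auto simp: der_simps u_def\<close>)
    obtain e e' where e: "lie_bracket D D3 = (\<lambda>p. e * D1 p + e' * D2 p)"
      using D3(4)[OF D] by (auto simp: V3_def)
    define u where "u = (if D1 = (\<lambda>_. 0) then 0 else e + a2 * c + D3 a1)"
    define v where "v = (if D2 = (\<lambda>_. 0) then 0 else e' + D3 a2)"
    have "u * D1 p + v * D2 p + D3 a3 * D3 p = 0" for p
    proof -
      have "(e + a2 * c + D3 a1) * D1 p + (e' + D3 a2) * D2 p + D3 a3 * D3 p =
        e * D1 p + e' * D2 p - lie_bracket D D3 p"
        by (simp add: lie_bracket_def Dp der_simps comm algebra_simps)
      also have "\<dots> = 0" by (simp add: e)
      finally have "(e + a2 * c + D3 a1) * D1 p + (e' + D3 a2) * D2 p + D3 a3 * D3 p = 0" .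
      then show ?thesis
        by (cases "D1 = (\<lambda>_. 0)"; cases "D2 = (\<lambda>_. 0)"; simp add: u_def v_def)
    qed
    then have 3: "u = 0 \<and> v = 0 \<and> D3 a3 = 0"
      by (rule indep) (use n in \<open>auto simp: der_simps u_def v_def\<close>)
    show "D1 a1 = 0" "D1 a2 = 0" "D2 a2 = 0" "a3 \<in> const" using 1 2 3 by (auto simp: const_def)
  qed
  have zero_coords: "a1 = 0 \<and> a2 = 0 \<and> a3 = 0" if "coords D a1 a2 a3" "D \<in> C N" for D a1 a2 a3
  proof (rule indep)
    have "D = (\<lambda>_. 0)" using that C(4) by blast
    then show "a1 * D1 p + a2 * D2 p + a3 * D3 p = 0" for p
      using that(1) unfolding coords_def by metis
  qed (use that in \<open>simp_all add: coords_def\<close>)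
  have bracket_coords: "coords (lie_bracket D2 D) (D2 a1 - a3 * c) 0 0"
    "coords (lie_bracket D3 D) (D3 a1 + a2 * c) (D3 a2) 0"
    if D: "D \<in> L" and co: "coords D a1 a2 a3" for D a1 a2 a3
  proof -
    note z = coefs[OF D co]
    have z3: "D1 a3 = 0" "D2 a3 = 0" "D3 a3 = 0" using z(4) by (auto simp: const_def)
    have Dp: "D p = a1 * D1 p + a2 * D2 p + a3 * D3 p" for p using co by (simp add: coords_def)
    have n: "D1 = (\<lambda>_. 0) \<Longrightarrow> a1 = 0" "D2 = (\<lambda>_. 0) \<Longrightarrow> a2 = 0" "D3 = (\<lambda>_. 0) \<Longrightarrow> a3 = 0"
      using co unfolding coords_def by simp_all
    show "coords (lie_bracket D2 D) (D2 a1 - a3 * c) 0 0"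
      unfolding coords_def
      by (intro conjI impI ext)
        (use n c(2) in \<open>simp_all add: lie_bracket_def Dp der_simps z z3 comm algebra_simps\<close>)
    show "coords (lie_bracket D3 D) (D3 a1 + a2 * c) (D3 a2) 0"
      unfolding coords_def
      by (intro conjI impI ext)
        (use n c(2) in \<open>simp_all add: lie_bracket_def Dp der_simps z z3 comm algebra_simps\<close>)
  qed
  \<comment> \<open>Multiples of \<open>D1\<close> come first: for them the terms in
    \<open>c\<close> drop out of \<open>bracket_coords\<close>. Since [D3, D2] is such a multiple,
    this bounds the level of \<open>c\<close>, which the general case needs. The induction descends
    from \<open>C N\<close>, whose elements are zero.\<close>
  have coords1: "e \<in> level (N - k)" if "coords D e 0 0" "D \<in> C k" "k \<le> N" for D e k
    using that(3,1,2)
  proof (induction k arbitrary: D e rule: inc_induct)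
    case base
    then show ?case using zero_coords[of D e 0 0] zero_level by simp
  next
    case (step k)
    have D: "D \<in> L" using C(2) step.prems by blast
    note b = bracket_coords[OF D step.prems(1)]
    have "D2 e \<in> level (N - Suc k)"
      using step.IH[of "lie_bracket D2 D" "D2 e"] b(1) C(3)[OF D2(1) step.prems(2)] by simp
    moreover have "D3 e \<in> level (N - Suc k)"
      using step.IH[of "lie_bracket D3 D" "D3 e"] b(2) C(3)[OF D3(1) step.prems(2)] by (simp add: der_simps)
    ultimately have "e \<in> level (Suc (N - Suc k))" using coefs(1)[OF D step.prems(1)] by simp
    then show ?case using step.hyps by (simp add: Suc_diff_Suc)
  qed
  have c_level: "c \<in> level N"
  proof -
    have "coords (lie_bracket D3 D2) c 0 0" using c by (simp add: coords_def)
    moreover have "lie_bracket D3 D2 \<in> C 0" using L_bracket[OF D3(1) D2(1)] C(1) by simp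
    ultimately show ?thesis using coords1[of _ c 0] by simp
  qed
  have "\<exists>m. \<forall>D\<in>C k. \<forall>a1 a2 a3. coords D a1 a2 a3 \<longrightarrow> a1 \<in> level m \<and> a2 \<in> level m" if "k \<le> N" for k
    using that
  proof (induction k rule: inc_induct)
    case base
    then show ?case using zero_coords zero_level by (intro exI[of _ 0]) metis
  next
    case (step k)
    then obtain m where m: "\<And>D a1 a2 a3. D \<in> C (Suc k) \<Longrightarrow> coords D a1 a2 a3 \<Longrightarrow> a1 \<in> level m \<and> a2 \<in> level m"
      by blast
    \<comment> \<open>One level above \<open>m\<close> is reached by \<open>a2\<close>, so
      \<open>a2 * c\<close> lies in \<open>level (Suc m + N)\<close>; this bounds the derivatives of
      \<open>a1\<close>, and \<open>a1\<close> itself lies one level higher.\<close>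
    have "a1 \<in> level (Suc (Suc m + N)) \<and> a2 \<in> level (Suc (Suc m + N))"
      if D: "D \<in> C k" and co: "coords D a1 a2 a3" for D a1 a2 a3
    proof -
      have DL: "D \<in> L" using C(2) D by blast
      note z = coefs[OF DL co] and b = bracket_coords[OF DL co]
      have b2: "D2 a1 - a3 * c \<in> level m" using m[OF C(3)[OF D2(1) D] b(1)] by simp
      have b3: "D3 a1 + a2 * c \<in> level m" "D3 a2 \<in> level m" using m[OF C(3)[OF D3(1) D] b(2)] by auto
      have a2: "a2 \<in> level (Suc m)" using b3(2) z zero_level by simp
      have mono: "level m \<subseteq> level (Suc m + N)" "level N \<subseteq> level (Suc m + N)"
        "level (Suc m) \<subseteq> level (Suc (Suc m + N))"
        by (intro level_mono; simp)+
      have "D2 a1 - a3 * c + a3 * c \<in> level (Suc m + N)"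
        using b2 mono level_const[OF z(4) c_level] by (intro level_add) blast+
      moreover have "D3 a1 + a2 * c - a2 * c \<in> level (Suc m + N)"
        using b3(1) mono level_mult[OF a2 c_level] by (intro level_diff) blast+
      ultimately have "a1 \<in> level (Suc (Suc m + N))" using z(1) by simp
      then show ?thesis using a2 mono by blast
    qed
    then show ?case by blast
  qed
  from this[of 0] obtain m where m: "\<And>D a1 a2 a3. D \<in> L \<Longrightarrow> coords D a1 a2 a3 \<Longrightarrow> a1 \<in> level m \<and> a2 \<in> level m"
    unfolding C(1) by blast
  \<comment> \<open>Each level is closed under sums and constant multiples, so the bound for
    \<open>L\<close> holds for FL unchanged.\<close>
  have alg_coords: "\<exists>a1 a2 a3. coords D a1 a2 a3 \<and> a1 \<in> level m \<and> a2 \<in> level m \<and> D2 a2 = 0 \<and> a3 \<in> const"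
    if "D \<in> alg" for D
    using that
  proof (induction rule: alg_induct)
    case zero
    then show ?case using zero_level subring_setD(1)[OF const_subring]
      by (intro exI[of _ 0]) (simp add: coords_def der_simps)
  next
    case (step r D E)
    from step(4) obtain b1 b2 b3 where b: "coords E b1 b2 b3"
      and b': "b1 \<in> level m" "b2 \<in> level m" "D2 b2 = 0" "b3 \<in> const" by blast
    obtain a1 a2 a3 where a: "coords D a1 a2 a3" using span[OF step(2)] by blast
    note a' = m[OF step(2) a] coefs[OF step(2) a]
    have r: "r \<in> const" "D2 r = 0" using step(1) const by (auto simp: const_def)
    have "coords (\<lambda>p. r * D p + E p) (r * a1 + b1) (r * a2 + b2) (r * a3 + b3)"
      using a b unfolding coords_def by (auto simp: algebra_simps)
    moreover have "r * a1 + b1 \<in> level m" "r * a2 + b2 \<in> level m" "r * a3 + b3 \<in> const"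
      using a' b' r level_add level_const subring_setD[OF const_subring] by auto
    moreover have "D2 (r * a2 + b2) = 0" by (simp add: der_simps r a' b')
    ultimately show ?case by blast
  qed
  have "adapted_algebra D1 D2 D3 c alg m"
  proof (intro adapted_algebra.intro adapted_algebra_axioms.intro)
    show "derivation_frame D1 D2 D3 c" by unfold_locales
    show "c \<in> nil_elems" using c_level by (rule nil_elemsI)
    show "D1 = (\<lambda>_. 0) \<Longrightarrow> c = 0" by (rule c(2))
    show "\<exists>a1 a2 a3. D = (\<lambda>p. a1 * D1 p + a2 * D2 p + a3 * D3 p) \<and>
      (D1 = (\<lambda>_. 0) \<longrightarrow> a1 = 0) \<and> (D2 = (\<lambda>_. 0) \<longrightarrow> a2 = 0) \<and> (D3 = (\<lambda>_. 0) \<longrightarrow> a3 = 0) \<and>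
      a1 \<in> level m \<and> a2 \<in> level m \<and> D2 a2 = 0 \<and> a3 \<in> const" if "D \<in> alg" for D
      using alg_coords[OF that] by (simp only: coords_def conj_assoc)
  qed (simp_all only: const, (rule indep zero_alg alg_add alg_scale alg_bracket; assumption)+)
  from adapted_algebra.isomorphic_triangular[OF this] show ?thesis unfolding const .
qed

end

section \<open>Extension of derivations to rational functions\<close>

text \<open>Horner's scheme, one variable after the other from the innermost outwards.\<close>

lemma derivation_poly3_eq_zero:
  fixes D :: "'k::field poly3 \<Rightarrow> 'k poly3"
  assumes D: "D \<in> derivations (range const3) UNIV" and x: "\<And>k. D (var3 k) = 0"
  shows "D p = 0"
proof -
  note d = derivation_simps[OF D]
  have 0: "D [:[:[:c:]:]:] = 0" for c
    using derivation_scalar[OF D, of "const3 c"] by (simp add: const3_def)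
  have 1: "D [:[:q:]:] = 0" for q
  proof (induction q)
    case 0
    then show ?case by (simp add: d)
  next
    case (pCons c q)
    have "[:[:pCons c q:]:] = [:[:[:c:]:]:] + var3 2 * [:[:q:]:]" by (simp add: var3_def)
    then show ?case by (simp only: d 0 x pCons.IH) simp
  qed
  have 2: "D [:q:] = 0" for q
  proof (induction q)
    case 0
    then show ?case by (simp add: d)
  next
    case (pCons c q)
    have "[:pCons c q:] = [:[:c:]:] + var3 1 * [:q:]" by (simp add: var3_def)
    then show ?case by (simp only: d 1 x pCons.IH) simp
  qed
  show ?thesis
  proof (induction p)
    case 0
    then show ?case by (simp add: d)
  next
    case (pCons c q)
    have "pCons c q = [:c:] + var3 0 * q" by (simp add: var3_def)
    then show ?case by (simp only: d 2 x pCons.IH) simp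
  qed
qed

lemma derivations_add:
  assumes "D \<in> derivations R UNIV" "E \<in> derivations R UNIV"
  shows "(\<lambda>p. D p + E p) \<in> derivations R UNIV"
  unfolding derivations_def
  by (auto simp: derivation_simps[OF assms(1)] derivation_simps[OF assms(2)]
      derivation_scalar[OF assms(1)] derivation_scalar[OF assms(2)] algebra_simps)

lemma derivations_scale:
  assumes "D \<in> derivations R UNIV"
  shows "(\<lambda>p. r * D p) \<in> derivations R UNIV"
  unfolding derivations_def
  by (auto simp: derivation_simps[OF assms] derivation_scalar[OF assms] algebra_simps)

lemma d_W3: "d1 \<in> W3" "d2 \<in> W3" "d3 \<in> W3"
  by (auto simp: W3_def derivations_def d_simps d_const3 algebra_simps)

lemma W3_expand:
  assumes D: "D \<in> W3"
  shows "D p = D (var3 0) * d1 p + D (var3 1) * d2 p + D (var3 2) * d3 p"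
proof -
  let ?E = "\<lambda>p. (D (var3 0) * d1 p + D (var3 1) * d2 p + D (var3 2) * d3 p) + (- 1) * D p"
  have "?E \<in> derivations (range const3) UNIV"
    using D d_W3 unfolding W3_def by (intro derivations_add derivations_scale)
  moreover have "?E (var3 k) = 0" for k
    by (simp add: var3_def d1_def d2_def d3_def map_poly_pCons pderiv_pCons pCons_one map_poly_1)
  ultimately have "?E p = 0" by (rule derivation_poly3_eq_zero)
  then show ?thesis by simp
qed

lemma extends_der_ext: "d \<in> W3 \<Longrightarrow> extends_der d (der_ext d)"
  unfolding der_ext_def by (rule theI'[OF der_ext_unique_existence])

lemma der_ext_eqI: "d \<in> W3 \<Longrightarrow> extends_der d D \<Longrightarrow> der_ext d = D"
  using der_ext_unique_existence extends_der_ext by blast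

lemma der_ext_derivation: "d \<in> W3 \<Longrightarrow> der_ext d \<in> derivations (range const_rat3) UNIV"
  using extends_der_ext by (auto simp: extends_der_def)

lemma der_ext_to_fract: "d \<in> W3 \<Longrightarrow> der_ext d (to_fract p) = to_fract (d p)"
  using extends_der_ext by (auto simp: extends_der_def)

lemma der_ext_zero: "der_ext (\<lambda>_. 0) = (\<lambda>_. 0)"
  by (rule der_ext_eqI) (auto simp: W3_def extends_der_def derivations_def)

text \<open>The bracket of the extensions extends the bracket, and extensions are unique.\<close>

lemma der_ext_bracket:
  assumes d: "d \<in> W3" "e \<in> W3"
  shows "der_ext (lie_bracket d e) = lie_bracket (der_ext d) (der_ext e)"
proof (rule der_ext_eqI)
  show "lie_bracket d e \<in> W3"
    using d unfolding W3_def by (rule derivation_lie_bracket)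
  show "extends_der (lie_bracket d e) (lie_bracket (der_ext d) (der_ext e))"
    unfolding extends_der_def
    using derivation_lie_bracket[OF der_ext_derivation[OF d(1)] der_ext_derivation[OF d(2)]]
    by (simp add: lie_bracket_def der_ext_to_fract d)
qed

text \<open>The right-hand side is an extension of \<open>d\<close> by \<open>W3_expand\<close>. The
  three partial derivatives thereby witness \<open>rank_le_3\<close>.\<close>

lemma der_ext_expand:
  assumes d: "d \<in> W3"
  shows "der_ext d r = to_fract (d (var3 0)) * der_ext d1 r + to_fract (d (var3 1)) * der_ext d2 r +
    to_fract (d (var3 2)) * der_ext d3 r"
proof -
  let ?E = "\<lambda>r. to_fract (d (var3 0)) * der_ext d1 r + to_fract (d (var3 1)) * der_ext d2 r +
    to_fract (d (var3 2)) * der_ext d3 r"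
  have "?E \<in> derivations (range const_rat3) UNIV"
    by (intro derivations_add derivations_scale der_ext_derivation d_W3)
  moreover have "?E (to_fract p) = to_fract (d p)" for p
    using W3_expand[OF d, of p] by (simp add: der_ext_to_fract d_W3)
  ultimately have "der_ext d = ?E" using d by (intro der_ext_eqI) (auto simp: extends_der_def)
  then show ?thesis by (rule fun_cong)
qed

lemma lower_central_subset:
  assumes "lie_subalgebra R L W"
  shows "lower_central R L n \<subseteq> L"
proof (induction n)
  case (Suc n)
  then show ?case unfolding lower_central.simps using assms
    by (intro lin_span_subset) (auto simp: lie_subalgebra_def)
qed simp

theorem corollary1:
  fixes L :: "('k::field_char_0 poly3 \<Rightarrow> 'k poly3) set"
    and F :: "'k ratfun3 set"
  assumes "lie_subalgebra (range const3) L W3"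
    and "nilpotent_lie (range const3) L"
    and "F = const_field L"
  shows "\<exists>M. lie_subalgebra (const3 ` F) M (u3 F) \<and> fin_dim_over (const3 ` F) M \<and>
             lie_isomorphic_over F const3 (scaled_alg F L) M"
proof -
  have W: "L \<subseteq> W3" and zero: "(\<lambda>_. 0) \<in> L" using assms(1) by (auto simp: lie_subalgebra_def)
  obtain N where N: "lower_central (range const3) L N = {\<lambda>_. 0}"
    using assms(2) by (auto simp: nilpotent_lie_def)
  define C where "C n = der_ext ` lower_central (range const3) L n" for n
  interpret nilpotent_derivations "der_ext ` L" C N "range const_rat3"
  proof unfold_locales
    show "D \<in> derivations (range const_rat3) UNIV" if "D \<in> der_ext ` L" for D
      using that W der_ext_derivation by blast
    show "1 \<in> range const_rat3"
      by (rule image_eqI[of _ _ 1]) (simp_all add: const_rat3_def const3_simps)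
    show "(\<lambda>_. 0) \<in> der_ext ` L" using imageI[OF zero, of der_ext] by (simp add: der_ext_zero)
    show "C 0 = der_ext ` L" "C n \<subseteq> der_ext ` L" for n
      using lower_central_subset[OF assms(1)] by (auto simp: C_def)
    show "C N \<subseteq> {\<lambda>_. 0}" by (simp add: C_def N der_ext_zero)
    show "lie_bracket D E \<in> C (Suc n)" if DE: "D \<in> der_ext ` L" "E \<in> C n" for D E n
    proof -
      obtain d e where d: "d \<in> L" "D = der_ext d" and e: "e \<in> lower_central (range const3) L n" "E = der_ext e"
        using DE by (auto simp: C_def)
      have "lie_bracket d e \<in> lower_central (range const3) L (Suc n)"
        unfolding lower_central.simps
      proof (rule lin_span_superset)
        show "1 \<in> range const3" by (rule image_eqI[of _ _ 1]) (simp_all add: const3_simps)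
      qed (use d e in blast)
      moreover have "e \<in> W3" using e(1) lower_central_subset[OF assms(1)] W by blast
      ultimately show ?thesis using d e W der_ext_bracket[of d e] by (force simp: C_def)
    qed
    show "\<exists>E :: nat \<Rightarrow> 'k ratfun3 \<Rightarrow> 'k ratfun3. \<forall>D\<in>der_ext ` L. \<exists>a. D = (\<lambda>p. \<Sum>i<3. a i * E i p)"
    proof (intro exI[of _ "\<lambda>i. der_ext (if i = 0 then d1 else if i = 1 then d2 else d3)"] ballI)
      fix D assume "D \<in> der_ext ` L"
      then obtain d where d: "d \<in> W3" "D = der_ext d" using W by blast
      have "D r = (\<Sum>i<(3::nat). to_fract (d (var3 i)) * der_ext (if i = 0 then d1 else if i = 1 then d2 else d3) r)" for r
        unfolding d(2) der_ext_expand[OF d(1), of r] by (simp add: eval_nat_numeral)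
      then show "\<exists>a. D = (\<lambda>p. \<Sum>i<(3::nat). a i * der_ext (if i = 0 then d1 else if i = 1 then d2 else d3) p)"
        by (intro exI[of _ "\<lambda>i. to_fract (d (var3 i))"] ext)
    qed
  qed
  have F: "constants = F" by (simp add: constants_def const_field_def assms(3))
  have "{(\<lambda>p. a * D p) | a D. a \<in> F \<and> D \<in> der_ext ` L} = {(\<lambda>r. a * der_ext D r) | a D. a \<in> F \<and> D \<in> L}"
    by blast
  then have "alg = scaled_alg F L" by (simp add: alg_def scaled_alg_def F)
  then show ?thesis using isomorphic_triangular by (simp add: F)
qed

end
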